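(* Let $P=(P_1,P_2,P_3)$ be the Pauli tuple and $\overline{P}=(P_1,P_2,-P_3)$ its entrywise complex conjugate. Then $\mathcal D_P=\mathcal D_P^\circ$ and $\mathcal D_{\overline{P}}=\mathcal D_{\overline{P}}^\circ$. Consequently $\mathcal D_P=\mathrm{mconv}(P)$, $P$ is a free extreme point of $\mathcal D_P$, every free extreme point of $\mathcal D_P$ is unitarily equivalent to $P$, and $\mathcal D_P$ is the matrix convex hull of its free extreme points.
   Context: $SM_n(\mathbb F)^g$ denotes the set of $g$-tuples of self-adjoint $n\times n$ matrices with entries in $\mathbb F\in\{\mathbb R,\mathbb C\}$, and $SM^g=\bigcup_n SM_n(\mathbb C)^g$. For $A=(A_1,\dots,A_g)\in SM_d(\mathbb C)^g$, the free spectrahedron is $\mathcal D_A=\bigcup_{n\ge1}\mathcal D_A(n)$ with $\mathcal D_A(n)=\{X\in SM_n(\mathbb C)^g: I-\sum_{i=1}^g A_i\otimes X_i\succeq 0\}$. A matrix convex set is a graded set $K=\bigcup_n K(n)$, $K(n)\subseteq SM_n^g$, closed under matrix convex combinations $\sum_{i} V_i^*X^{(i)}V_i$ with $X^{(i)}\in K(n_i)$, $V_i\in M_{n_i\times n}$, $\sum_i V_i^*V_i=I_n$; $\mathrm{mconv}(S)$ is the smallest matrix convex set containing $S$ (no closure). The free polar dual of a matrix convex set $K$ in $g$ variables is $K^\circ=\{X\in SM^g:\ \sum_{i=1}^g Y_i\otimes X_i\preceq I \text{ for all } Y\in K\}$. A point $X\in K(n)$ is a free extreme point of $K$ if whenever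 $X=\sum_i V_i^*X^{(i)}V_i$ is a matrix convex combination of points $X^{(i)}\in K$ with all $V_i\neq0$, each $X^{(i)}$ is unitarily equivalent to $X$ or to $X\oplus Z$ for some $Z\in K$. The Pauli tuple is $P=\left(\begin{bmatrix}1&0\\0&-1\end{bmatrix},\begin{bmatrix}0&1\\1&0\end{bmatrix},\begin{bmatrix}0&i\\-i&0\end{bmatrix}\right)$. *)

theory Defs
  imports "Jordan_Normal_Form.Matrix" "HOL.Complex"
begin

definition adj :: "complex mat \<Rightarrow> complex mat" where
  "adj A = mat (dim_col A) (dim_row A) (\<lambda>(i,j). cnj (A $$ (j,i)))"

definition psd :: "nat \<Rightarrow> complex mat \<Rightarrow> bool" where
  "psd n A \<longleftrightarrow> A \<in> carrier_mat n n \<and> adj A = A \<and>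
     (\<forall>v \<in> carrier_vec n. 0 \<le> Re (map_vec cnj v \<bullet> (A *\<^sub>v v)))"

definition unitary :: "nat \<Rightarrow> complex mat \<Rightarrow> bool" where
  "unitary n U \<longleftrightarrow> U \<in> carrier_mat n n \<and> adj U * U = 1\<^sub>m n \<and> U * adj U = 1\<^sub>m n"

definition kron :: "complex mat \<Rightarrow> complex mat \<Rightarrow> complex mat" where
  "kron A B = mat (dim_row A * dim_row B) (dim_col A * dim_col B)
     (\<lambda>(i,j). A $$ (i div dim_row B, j div dim_col B) * B $$ (i mod dim_row B, j mod dim_col B))"

definition SM :: "nat \<Rightarrow> nat \<Rightarrow> complex mat list set" where
  "SM n g = {X. length X = g \<and> (\<forall>j<g. X ! j \<in> carrier_mat n n \<and> adj (X ! j) = X ! j)}"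

(* the size n of a tuple in SM_n^g (g \<ge> 1) *)
definition tdim :: "complex mat list \<Rightarrow> nat" where
  "tdim X = dim_row (hd X)"

definition SMall :: "nat \<Rightarrow> complex mat list set" where
  "SMall g = {X. \<exists>n\<ge>1. X \<in> SM n g}"

definition pencil :: "nat \<Rightarrow> nat \<Rightarrow> complex mat list \<Rightarrow> complex mat list \<Rightarrow> complex mat" where
  "pencil d n A X = foldr (+) (map (\<lambda>i. kron (A ! i) (X ! i)) [0..<length A]) (0\<^sub>m (d*n) (d*n))"

definition free_spec :: "nat \<Rightarrow> complex mat list \<Rightarrow> complex mat list set" where
  "free_spec d A = {X. \<exists>n\<ge>1. X \<in> SM n (length A) \<and> psd (d*n) (1\<^sub>m (d*n) - pencil d n A X)}"

definition free_polar :: "nat \<Rightarrow> complex mat list set \<Rightarrow> complex mat list set" where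
  "free_polar g K = {X. \<exists>n\<ge>1. X \<in> SM n g \<and>
     (\<forall>Y\<in>K. psd (tdim Y * n) (1\<^sub>m (tdim Y * n) - pencil (tdim Y) n Y X))}"

definition mcomb :: "nat \<Rightarrow> nat \<Rightarrow> (complex mat list \<times> complex mat) list \<Rightarrow> complex mat list" where
  "mcomb g n L = map (\<lambda>j. foldr (+) (map (\<lambda>(X,V). adj V * (X ! j) * V) L) (0\<^sub>m n n)) [0..<g]"

definition mcomb_ok :: "complex mat list set \<Rightarrow> nat \<Rightarrow> (complex mat list \<times> complex mat) list \<Rightarrow> bool" where
  "mcomb_ok K n L \<longleftrightarrow> L \<noteq> [] \<and> n \<ge> 1 \<and>
     (\<forall>(X,V)\<in>set L. X \<in> K \<and> V \<in> carrier_mat (tdim X) n) \<and>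
     foldr (+) (map (\<lambda>(X,V). adj V * V) L) (0\<^sub>m n n) = 1\<^sub>m n"

definition matrix_convex :: "nat \<Rightarrow> complex mat list set \<Rightarrow> bool" where
  "matrix_convex g K \<longleftrightarrow> K \<subseteq> SMall g \<and>
     (\<forall>n L. mcomb_ok K n L \<longrightarrow> mcomb g n L \<in> K)"

definition mconv :: "nat \<Rightarrow> complex mat list set \<Rightarrow> complex mat list set" where
  "mconv g S = \<Inter>{K. matrix_convex g K \<and> S \<subseteq> K}"

definition uequiv :: "complex mat list \<Rightarrow> complex mat list \<Rightarrow> bool" where
  "uequiv X Y \<longleftrightarrow> length X = length Y \<and> tdim X = tdim Y \<and>
     (\<exists>U. unitary (tdim X) U \<and> (\<forall>j<length X. X ! j = adj U * (Y ! j) * U))"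

definition dsum :: "complex mat list \<Rightarrow> complex mat list \<Rightarrow> complex mat list" where
  "dsum X Z = map (\<lambda>(A,B). four_block_mat A (0\<^sub>m (dim_row A) (dim_col B)) (0\<^sub>m (dim_row B) (dim_col A)) B)
     (zip X Z)"

definition free_extreme :: "nat \<Rightarrow> complex mat list set \<Rightarrow> complex mat list \<Rightarrow> bool" where
  "free_extreme g K X \<longleftrightarrow> X \<in> K \<and>
     (\<forall>L. mcomb_ok K (tdim X) L \<and> (\<forall>(Y,V)\<in>set L. V \<noteq> 0\<^sub>m (tdim Y) (tdim X)) \<and>
          X = mcomb g (tdim X) L
        \<longrightarrow> (\<forall>(Y,V)\<in>set L. uequiv Y X \<or> (\<exists>Z\<in>K. uequiv Y (dsum X Z))))"

definition pauli :: "complex mat list" where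
  "pauli = [mat_of_rows_list 2 [[1, 0], [0, -1]],
            mat_of_rows_list 2 [[0, 1], [1, 0]],
            mat_of_rows_list 2 [[0, \<i>], [-\<i>, 0]]]"

definition pauli_bar :: "complex mat list" where
  "pauli_bar = [mat_of_rows_list 2 [[1, 0], [0, -1]],
                mat_of_rows_list 2 [[0, 1], [1, 0]],
                mat_of_rows_list 2 [[0, -\<i>], [\<i>, 0]]]"

end

(* A tuple X lies in D_P iff the Choi matrix of the linear map P_j -> X_j, I -> I on M_2 is positive:
   conjugation by [[0,1],[-1,0]] in the first tensor factor turns I - sum P_j (x) X_j into that Choi
   matrix, which gives D_P = mconv(P).  Polarity only needs to be tested on P, and I - sum Y_j (x) X_j
   is symmetric in X and Y up to a flip of the tensor factors, so D_P is its own polar.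

   If P = sum V^* Y V with all Y in D_P, then on the kernel of I - sum P_j (x) P_j (the symmetric
   2 x 2 matrices) every summand of the quadratic form vanishes; positivity turns this into linear
   equations that say Y_j V = V P_j.  Hence V is a multiple of an isometry onto a subspace reducing Y. *)
theory Submission
  imports Defs "Jordan_Normal_Form.Determinant"
begin

section \<open>Adjoints and matrix sums\<close>

text \<open>Two facts make the Pauli tuple special. With J = [[0,1],[-1,0]], each J P_j J^{-1} is
  minus the transpose of P_j: this cancels the minus sign of the pencil and supplies the transpose
  that a Choi matrix carries. And \<open>sum P_j \<otimes> P_j\<close> equals 2 SWAP - I, so the
  form of P against itself vanishes exactly on symmetric matrices, a space large enough to determine
  every \<open>Y_j * V\<close>. Positivity is handled through a form in which a coefficient V of a
  matrix convex combination moves from the tuple to the test matrix. This gives convexity of free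
  spectrahedra, the reduction of polarity to P, and the vanishing of summands. Kraus operators and
  null vectors both come from splitting a positive kernel into rank-one terms by Schur complements.
  For uniqueness: every X in D_P combines copies of P, so an extreme X makes P equivalent to X or to
  \<open>X \<oplus> Z\<close>, and irreducibility of P excludes the latter. The conjugate tuple is
  reached by a sign change in the third coordinate, which passes from one tensor factor to the
  other.\<close>

lemma adj_index [simp]:
  "i < dim_col A \<Longrightarrow> j < dim_row A \<Longrightarrow> adj A $$ (i,j) = cnj (A $$ (j,i))"
  by (simp add: adj_def)

lemma adj_dim [simp]: "dim_row (adj A) = dim_col A" "dim_col (adj A) = dim_row A"
  by (simp_all add: adj_def)

lemma adj_carrier [simp]: "A \<in> carrier_mat m n \<Longrightarrow> adj A \<in> carrier_mat n m"
  by (simp add: adj_def)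

lemma adj_adj [simp]: "adj (adj A) = A"
  by (rule eq_matI) auto

lemma mult_index_sum:
  assumes "A \<in> carrier_mat m n" "B \<in> carrier_mat n k" "i < m" "j < k"
  shows "(A * B) $$ (i,j) = (\<Sum>a<n. A $$ (i,a) * B $$ (a,j))"
  using assms by (simp add: scalar_prod_def atLeast0LessThan)

lemma adj_mult:
  assumes "A \<in> carrier_mat m n" "B \<in> carrier_mat n k"
  shows "adj (A * B) = adj B * adj A"
  using assms
  by (intro eq_matI) (auto simp: scalar_prod_def mult.commute)

lemma adj_add:
  assumes "A \<in> carrier_mat m n" "B \<in> carrier_mat m n"
  shows "adj (A + B) = adj A + adj B"
  using assms by (intro eq_matI) auto

lemma adj_zero [simp]: "adj (0\<^sub>m m n) = 0\<^sub>m n m"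
  by (intro eq_matI) auto

lemma triple_index_sum:
  assumes "A \<in> carrier_mat m k" "M \<in> carrier_mat m n" "B \<in> carrier_mat n l" "i < k" "j < l"
  shows "(adj A * M * B) $$ (i,j) = (\<Sum>b<n. \<Sum>a<m. cnj (A $$ (a,i)) * M $$ (a,b) * B $$ (b,j))"
proof -
  have "(adj A * M) $$ (i,b) = (\<Sum>a<m. cnj (A $$ (a,i)) * M $$ (a,b))" if "b < n" for b
    using assms that by (subst mult_index_sum[of _ k m _ n]) auto
  then show ?thesis
    using assms by (subst mult_index_sum[of _ k n _ l]) (auto simp: sum_distrib_right)
qed

lemma foldr_mat_carrier:
  assumes "\<And>x. x \<in> set xs \<Longrightarrow> f x \<in> carrier_mat m n"
  shows "foldr (+) (map f xs) (0\<^sub>m m n) \<in> carrier_mat m n"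
  using assms by (induction xs) auto

lemma foldr_mat_index:
  fixes f :: "'a \<Rightarrow> 'b :: comm_monoid_add mat"
  assumes "\<And>x. x \<in> set xs \<Longrightarrow> f x \<in> carrier_mat m n" "i < m" "j < n"
  shows "foldr (+) (map f xs) (0\<^sub>m m n) $$ (i,j) = (\<Sum>x\<leftarrow>xs. f x $$ (i,j))"
  using assms
proof (induction xs)
  case (Cons x xs)
  have "foldr (+) (map f xs) (0\<^sub>m m n) \<in> carrier_mat m n"
    using Cons.prems by (intro foldr_mat_carrier) auto
  with Cons show ?case by auto
qed auto

lemma foldr_mat_adj:
  assumes "\<And>x. x \<in> set xs \<Longrightarrow> f x \<in> carrier_mat n n" "\<And>x. x \<in> set xs \<Longrightarrow> adj (f x) = f x"
  shows "adj (foldr (+) (map f xs) (0\<^sub>m n n)) = foldr (+) (map f xs) (0\<^sub>m n n)"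
  using assms
proof (induction xs)
  case (Cons x xs)
  have "foldr (+) (map f xs) (0\<^sub>m n n) \<in> carrier_mat n n"
    using Cons.prems by (intro foldr_mat_carrier) auto
  with Cons show ?case by (auto simp: adj_add[of _ n n])
qed auto

lemma SM_carrier: "X \<in> SM n g \<Longrightarrow> j < g \<Longrightarrow> X ! j \<in> carrier_mat n n"
  and SM_adj: "X \<in> SM n g \<Longrightarrow> j < g \<Longrightarrow> adj (X ! j) = X ! j"
  and SM_length: "X \<in> SM n g \<Longrightarrow> length X = g"
  by (auto simp: SM_def)

lemma SM_tdim:
  assumes "X \<in> SM n g" "0 < g"
  shows "tdim X = n"
proof -
  have "hd X = X ! 0"
    using assms by (intro hd_conv_nth) (auto simp: SM_def)
  then show ?thesis
    using SM_carrier[OF assms] by (simp add: tdim_def)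
qed

text \<open>The Hilbert-Schmidt inner product, the trace of \<open>adj A * B\<close>, conjugate
  linear in the first argument.\<close>

definition ip :: "complex mat \<Rightarrow> complex mat \<Rightarrow> complex" where
  "ip A B = (\<Sum>i<dim_row A. \<Sum>j<dim_col A. cnj (A $$ (i,j)) * B $$ (i,j))"

lemma ip_add_right:
  assumes "A \<in> carrier_mat m n" "B \<in> carrier_mat m n" "C \<in> carrier_mat m n"
  shows "ip A (B + C) = ip A B + ip A C"
  using assms by (simp add: ip_def distrib_left sum.distrib)

lemma ip_transpose:
  assumes "A \<in> carrier_mat m n" "B \<in> carrier_mat m n"
  shows "ip (transpose_mat A) (transpose_mat B) = ip A B"
  unfolding ip_def using assms by (subst sum.swap) simp

lemma ip_adj_mult:
  assumes "V \<in> carrier_mat m n" "A \<in> carrier_mat n k" "B \<in> carrier_mat m k"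
  shows "ip A (adj V * B) = ip (V * A) B"
proof -
  have "ip A (adj V * B) = (\<Sum>i<n. \<Sum>j<k. \<Sum>a<m. cnj (A $$ (i,j)) * (cnj (V $$ (a,i)) * B $$ (a,j)))"
    using assms by (auto simp: ip_def mult_index_sum[of _ n m _ k] sum_distrib_left
        simp del: index_mult_mat(1) intro!: sum.cong)
  also have "\<dots> = (\<Sum>a<m. \<Sum>j<k. \<Sum>i<n. cnj (A $$ (i,j)) * (cnj (V $$ (a,i)) * B $$ (a,j)))"
    by (subst (2) sum.swap, subst sum.swap, subst (2) sum.swap) (rule refl)
  also have "\<dots> = ip (V * A) B"
    using assms by (auto simp: ip_def mult_index_sum[of V m n A k] sum_distrib_right sum_distrib_left mult_ac
        simp del: index_mult_mat(1) intro!: sum.cong)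
  finally show ?thesis .
qed

text \<open>The mechanism behind matrix convexity: a coefficient \<open>V\<close> attached to the
  tuple is absorbed by the test matrix, which changes from \<open>Z\<close> to
  \<open>V * Z\<close>.\<close>

lemma ip_congruence:
  assumes "V \<in> carrier_mat m n" "M \<in> carrier_mat m m" "N \<in> carrier_mat k k" "Z \<in> carrier_mat n k"
  shows "ip Z (adj V * M * V * Z * N) = ip (V * Z) (M * (V * Z) * N)"
proof -
  have "adj V * M * V * Z * N = adj V * (M * (V * Z) * N)"
    using assms
    by (simp add: assoc_mult_mat[of _ n m _ m _ n] assoc_mult_mat[of _ n m _ n _ k]
        assoc_mult_mat[of _ n m _ k _ k] assoc_mult_mat[of _ m m _ n _ k])
  then show ?thesis
    using assms by (simp only:) (rule ip_adj_mult[of _ m n _ k], auto)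
qed

lemma ip_foldr:
  assumes "\<And>x. x \<in> set xs \<Longrightarrow> f x \<in> carrier_mat n n" "Z \<in> carrier_mat n k" "N \<in> carrier_mat k k"
  shows "ip Z (foldr (+) (map f xs) (0\<^sub>m n n) * Z * N) = (\<Sum>x\<leftarrow>xs. ip Z (f x * Z * N))"
  using assms(1)
proof (induction xs)
  case Nil
  then show ?case using assms(2,3) by (simp add: ip_def)
next
  case (Cons x xs)
  let ?R = "foldr (+) (map f xs) (0\<^sub>m n n)"
  have R: "?R \<in> carrier_mat n n" "f x \<in> carrier_mat n n"
    using Cons.prems by (auto intro!: foldr_mat_carrier)
  have "(f x + ?R) * Z * N = f x * Z * N + ?R * Z * N"
    using R assms(2,3) by (simp add: add_mult_distrib_mat[of _ n n _ _ k] add_mult_distrib_mat[of _ n k _ _ k])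
  then have "ip Z ((f x + ?R) * Z * N) = ip Z (f x * Z * N) + ip Z (?R * Z * N)"
    using R assms(2,3) by (simp add: ip_add_right[of _ n k])
  with Cons show ?case by simp
qed

section \<open>The quadratic form of a pencil\<close>

text \<open>Identifying a vector of length $dn$ with a $d \times n$ matrix $Z$ turns $Y_t \otimes X_t$ into
  $Z \mapsto Y_t Z X_t^T$.\<close>

definition form :: "complex mat list \<Rightarrow> complex mat list \<Rightarrow> complex mat \<Rightarrow> complex" where
  "form Y X Z = ip Z Z - (\<Sum>t<length Y. ip Z (Y ! t * Z * transpose_mat (X ! t)))"

text \<open>The entries of \<open>I - sum Y_t \<otimes> X_t\<close>, indexed by pairs instead of
  positions \<open>i * n + p\<close>. Division and remainder thus stay confined to the comparison
  with \<open>kron\<close>, and the factorization below applies to an arbitrary finite index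
  set.\<close>

definition pencil_kernel ::
  "complex mat list \<Rightarrow> complex mat list \<Rightarrow> nat \<times> nat \<Rightarrow> nat \<times> nat \<Rightarrow> complex" where
  "pencil_kernel Y X a b = of_bool (a = b) -
     (\<Sum>t<length Y. Y ! t $$ (fst a, fst b) * X ! t $$ (snd a, snd b))"

text \<open>Transposing the test matrix is the flip of the two tensor factors.\<close>

lemma form_commute:
  assumes "Y \<in> SM d g" "X \<in> SM n g" "Z \<in> carrier_mat d n"
  shows "form X Y (transpose_mat Z) = form Y X Z"
proof -
  have "ip (transpose_mat Z) (X ! t * transpose_mat Z * transpose_mat (Y ! t)) =
      ip Z (Y ! t * Z * transpose_mat (X ! t))" if "t < g" for t
  proof -
    have c: "X ! t \<in> carrier_mat n n" "Y ! t \<in> carrier_mat d d"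
      using assms that by (auto intro: SM_carrier)
    have "X ! t * transpose_mat Z * transpose_mat (Y ! t) =
        transpose_mat (Y ! t * Z * transpose_mat (X ! t))"
      using c assms(3) by (simp add: transpose_mult[of _ d n _ n] transpose_mult[of _ d d _ n])
    then show ?thesis
      using c assms(3) by (simp only:) (rule ip_transpose[of _ d n], auto)
  qed
  moreover have "length X = g" "length Y = g"
    using assms by (auto simp: SM_length)
  ultimately show ?thesis
    using assms(3) by (simp add: form_def ip_transpose[of _ d n])
qed

lemma form_expand:
  assumes "Y \<in> SM d g" "X \<in> SM n g" "Z \<in> carrier_mat d n"
  shows "form Y X Z = (\<Sum>a\<in>{..<d} \<times> {..<n}. \<Sum>b\<in>{..<d} \<times> {..<n}.
    cnj (Z $$ a) * pencil_kernel Y X a b * Z $$ b)"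
proof -
  let ?S = "{..<d} \<times> {..<n}"
  have len: "length Y = g"
    using assms by (simp add: SM_length)
  have id: "ip Z Z = (\<Sum>a\<in>?S. \<Sum>b\<in>?S. cnj (Z $$ a) * of_bool (a = b) * Z $$ b)"
  proof -
    have "ip Z Z = (\<Sum>a\<in>?S. cnj (Z $$ a) * Z $$ a)"
      using assms(3) by (simp add: ip_def sum.cartesian_product split_beta)
    also have "\<dots> = (\<Sum>a\<in>?S. \<Sum>b\<in>?S. cnj (Z $$ a) * of_bool (a = b) * Z $$ b)"
      by (intro sum.cong refl) (auto simp: of_bool_def if_distrib if_distribR sum.delta cong: if_cong)
    finally show ?thesis .
  qed
  have t: "ip Z (Y ! t * Z * transpose_mat (X ! t)) =
      (\<Sum>a\<in>?S. \<Sum>b\<in>?S. cnj (Z $$ a) * (Y ! t $$ (fst a, fst b) * X ! t $$ (snd a, snd b)) * Z $$ b)"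
    if "t < g" for t
  proof -
    have c: "X ! t \<in> carrier_mat n n" "Y ! t \<in> carrier_mat d d"
      using assms that by (auto intro: SM_carrier)
    have e: "(Y ! t * Z * transpose_mat (X ! t)) $$ (i,p) =
        (\<Sum>q<n. \<Sum>j<d. Y ! t $$ (i,j) * Z $$ (j,q) * X ! t $$ (p,q))" if "i < d" "p < n" for i p
    proof -
      have "(Y ! t * Z * transpose_mat (X ! t)) $$ (i,p) =
          (\<Sum>q<n. (Y ! t * Z) $$ (i,q) * transpose_mat (X ! t) $$ (q,p))"
        using c assms(3) that by (intro mult_index_sum[of _ d n _ n]) auto
      also have "\<dots> = (\<Sum>q<n. \<Sum>j<d. Y ! t $$ (i,j) * Z $$ (j,q) * X ! t $$ (p,q))"
        using c assms(3) that
        by (intro sum.cong refl) (simp add: mult_index_sum[of _ d d _ n] sum_distrib_right del: index_mult_mat(1))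
      finally show ?thesis .
    qed
    have "ip Z (Y ! t * Z * transpose_mat (X ! t)) =
        (\<Sum>i<d. \<Sum>p<n. cnj (Z $$ (i,p)) * (\<Sum>q<n. \<Sum>j<d. Y ! t $$ (i,j) * Z $$ (j,q) * X ! t $$ (p,q)))"
      using assms(3) by (simp add: ip_def e del: index_mult_mat(1))
    also have "\<dots> = (\<Sum>i<d. \<Sum>p<n. \<Sum>j<d. \<Sum>q<n.
        cnj (Z $$ (i,p)) * (Y ! t $$ (i,j) * X ! t $$ (p,q)) * Z $$ (j,q))"
      by (subst (3) sum.swap) (simp add: sum_distrib_left mult_ac)
    also have "\<dots> = (\<Sum>a\<in>?S. \<Sum>b\<in>?S.
        cnj (Z $$ a) * (Y ! t $$ (fst a, fst b) * X ! t $$ (snd a, snd b)) * Z $$ b)"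
      by (simp add: sum.cartesian_product')
    finally show ?thesis .
  qed
  have "(\<Sum>t<g. ip Z (Y ! t * Z * transpose_mat (X ! t))) =
      (\<Sum>a\<in>?S. \<Sum>b\<in>?S. \<Sum>t<g. cnj (Z $$ a) * (Y ! t $$ (fst a, fst b) * X ! t $$ (snd a, snd b)) * Z $$ b)"
  proof -
    have "(\<Sum>t<g. ip Z (Y ! t * Z * transpose_mat (X ! t))) =
        (\<Sum>t<g. \<Sum>a\<in>?S. \<Sum>b\<in>?S. cnj (Z $$ a) * (Y ! t $$ (fst a, fst b) * X ! t $$ (snd a, snd b)) * Z $$ b)"
      by (rule sum.cong[OF refl], rule t) simp
    also have "\<dots> = (\<Sum>a\<in>?S. \<Sum>t<g. \<Sum>b\<in>?S. cnj (Z $$ a) * (Y ! t $$ (fst a, fst b) * X ! t $$ (snd a, snd b)) * Z $$ b)"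
      by (rule sum.swap)
    finally show ?thesis
      by (simp only: sum.swap[of _ ?S "{..<g}"])
  qed
  then show ?thesis
    unfolding form_def id pencil_kernel_def len
    by (simp only: right_diff_distrib left_diff_distrib sum_subtractf sum_distrib_left sum_distrib_right)
qed

lemma block_index_less:
  fixes i p d n :: nat
  assumes "i < d" "p < n"
  shows "i * n + p < d * n"
proof -
  have "i * n + p < i * n + n"
    using assms by (intro add_strict_left_mono)
  also have "\<dots> = Suc i * n" 
    by (simp only: mult_Suc add.commute)
  also have "\<dots> \<le> d * n"
    using assms by (intro mult_le_mono1 Suc_leI)
  finally show ?thesis .
qed

lemma kron_carrier [simp]:
  "A \<in> carrier_mat d d \<Longrightarrow> B \<in> carrier_mat n n \<Longrightarrow> kron A B \<in> carrier_mat (d * n) (d * n)"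
  by (intro carrier_matI) (simp_all add: kron_def)

lemma kron_adj:
  assumes "A \<in> carrier_mat d d" "B \<in> carrier_mat n n"
  shows "adj (kron A B) = kron (adj A) (adj B)"
proof -
  have "i div n < d \<and> i mod n < n" if "i < d * n" for i
    using that by (cases "n = 0") (auto simp: less_mult_imp_div_less)
  with assms show ?thesis
    by (intro eq_matI) (auto simp: kron_def)
qed

lemma pencil_carrier:
  assumes "Y \<in> SM d g" "X \<in> SM n g"
  shows "pencil d n Y X \<in> carrier_mat (d * n) (d * n)"
  unfolding pencil_def using assms
  by (intro foldr_mat_carrier kron_carrier) (auto simp: SM_def)

lemma pencil_adj:
  assumes "Y \<in> SM d g" "X \<in> SM n g"
  shows "adj (pencil d n Y X) = pencil d n Y X"
  unfolding pencil_def
proof (rule foldr_mat_adj)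
  fix t assume "t \<in> set [0..<length Y]"
  then have "t < g"
    using assms by (simp add: SM_def)
  then have *: "Y ! t \<in> carrier_mat d d" "X ! t \<in> carrier_mat n n" "adj (Y ! t) = Y ! t" "adj (X ! t) = X ! t"
    using assms by (auto simp: SM_def)
  then show "kron (Y ! t) (X ! t) \<in> carrier_mat (d * n) (d * n)"
    by simp
  show "adj (kron (Y ! t) (X ! t)) = kron (Y ! t) (X ! t)"
    using * by (simp add: kron_adj[of _ d _ n])
qed

lemma pencil_index:
  assumes "Y \<in> SM d g" "X \<in> SM n g" "i < d" "j < d" "p < n" "q < n"
  shows "(1\<^sub>m (d * n) - pencil d n Y X) $$ (i * n + p, j * n + q) = pencil_kernel Y X (i,p) (j,q)"
proof -
  have len: "length Y = g"
    using assms by (simp add: SM_length)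
  have kr: "kron (Y ! t) (X ! t) \<in> carrier_mat (d * n) (d * n)"
    "kron (Y ! t) (X ! t) $$ (i * n + p, j * n + q) = Y ! t $$ (i,j) * X ! t $$ (p,q)" if "t < g" for t
  proof -
    have c: "X ! t \<in> carrier_mat n n" "Y ! t \<in> carrier_mat d d"
      using assms that by (auto intro: SM_carrier)
    then show "kron (Y ! t) (X ! t) \<in> carrier_mat (d * n) (d * n)"
      by simp
    show "kron (Y ! t) (X ! t) $$ (i * n + p, j * n + q) = Y ! t $$ (i,j) * X ! t $$ (p,q)"
      using c block_index_less assms by (simp add: kron_def)
  qed
  have "pencil d n Y X $$ (i * n + p, j * n + q) =
      (\<Sum>t\<leftarrow>[0..<g]. kron (Y ! t) (X ! t) $$ (i * n + p, j * n + q))"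
    unfolding pencil_def len using block_index_less assms kr(1)
    by (intro foldr_mat_index) simp_all
  also have "\<dots> = (\<Sum>t\<leftarrow>[0..<g]. Y ! t $$ (i,j) * X ! t $$ (p,q))"
    by (intro arg_cong[of _ _ sum_list] map_cong refl) (simp add: kr(2))
  also have "\<dots> = (\<Sum>t<g. Y ! t $$ (i,j) * X ! t $$ (p,q))"
    by (simp add: interv_sum_list_conv_sum_set_nat atLeast0LessThan)
  moreover have "i * n + p = j * n + q \<longleftrightarrow> (i,p) = (j,q)"
  proof
    assume "i * n + p = j * n + q"
    then have "(i * n + p) div n = (j * n + q) div n" "(i * n + p) mod n = (j * n + q) mod n"
      by simp_all
    then show "(i,p) = (j,q)"
      using assms by simp
  qed auto
  ultimately show ?thesis
    using pencil_carrier[OF assms(1,2)] block_index_less assms by (simp add: pencil_kernel_def len)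
qed

lemma quadratic_form_expand:
  assumes "A \<in> carrier_mat N N" "v \<in> carrier_vec N"
  shows "map_vec cnj v \<bullet> (A *\<^sub>v v) = (\<Sum>a<N. \<Sum>b<N. cnj (v $ a) * A $$ (a,b) * v $ b)"
  using assms by (simp add: scalar_prod_def atLeast0LessThan sum_distrib_left mult.assoc)

text \<open>Reading a vector row by row as a matrix identifies the two quadratic forms. Past the
  characterizations of \<open>free_spec\<close> and \<open>free_polar\<close>, positivity is only
  ever used in terms of \<open>form\<close>.\<close>

lemma psd_pencil_iff:
  assumes "Y \<in> SM d g" "X \<in> SM n g"
  shows "psd (d * n) (1\<^sub>m (d * n) - pencil d n Y X) \<longleftrightarrow>
    (\<forall>Z\<in>carrier_mat d n. 0 \<le> Re (form Y X Z))"
proof -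
  let ?A = "1\<^sub>m (d * n) - pencil d n Y X" and ?S = "{..<d} \<times> {..<n}"
  let ?h = "\<lambda>(i,p). i * n + p"
  have A: "?A \<in> carrier_mat (d * n) (d * n)" "adj ?A = ?A"
  proof -
    show "?A \<in> carrier_mat (d * n) (d * n)"
      using pencil_carrier[OF assms] by (simp add: minus_carrier_mat)
    have "cnj (pencil d n Y X $$ (j,i)) = pencil d n Y X $$ (i,j)" if "i < d * n" "j < d * n" for i j
      using pencil_carrier[OF assms] that arg_cong[OF pencil_adj[OF assms], of "\<lambda>M. M $$ (i,j)"] by simp
    then show "adj ?A = ?A"
      using pencil_carrier[OF assms] by (intro eq_matI) auto
  qed
  have bij: "bij_betw ?h ?S {..<d * n}"
  proof (rule bij_betw_byWitness[where f' = "\<lambda>a. (a div n, a mod n)"])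
    show "(\<lambda>a. (a div n, a mod n)) ` {..<d * n} \<subseteq> ?S"
      by (cases "n = 0") (auto simp: less_mult_imp_div_less)
    show "?h ` ?S \<subseteq> {..<d * n}"
      by (auto intro: block_index_less)
  qed auto
  have vec: "map_vec cnj v \<bullet> (?A *\<^sub>v v) = form Y X (mat d n (\<lambda>a. v $ ?h a))"
    if "v \<in> carrier_vec (d * n)" for v
  proof -
    have "map_vec cnj v \<bullet> (?A *\<^sub>v v) =
        (\<Sum>a\<in>?S. \<Sum>b\<in>?S. cnj (v $ ?h a) * ?A $$ (?h a, ?h b) * v $ ?h b)"
      unfolding quadratic_form_expand[OF A(1) that] by (simp only: sum.reindex_bij_betw[OF bij, symmetric])
    also have "\<dots> = form Y X (mat d n (\<lambda>a. v $ ?h a))"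
      unfolding form_expand[OF assms mat_carrier]
    proof (intro sum.cong refl)
      fix a b assume "a \<in> ?S" "b \<in> ?S"
      then show "cnj (v $ ?h a) * ?A $$ (?h a, ?h b) * v $ ?h b = cnj (mat d n (\<lambda>a. v $ ?h a) $$ a) *
          pencil_kernel Y X a b * mat d n (\<lambda>a. v $ ?h a) $$ b"
        using pencil_index[OF assms] by (auto simp del: index_minus_mat)
    qed
    finally show ?thesis .
  qed
  show ?thesis
  proof
    assume *: "psd (d * n) ?A"
    show "\<forall>Z\<in>carrier_mat d n. 0 \<le> Re (form Y X Z)"
    proof
      fix Z :: "complex mat" assume Z: "Z \<in> carrier_mat d n"
      let ?v = "vec (d * n) (\<lambda>a. Z $$ (a div n, a mod n))"
      have "mat d n (\<lambda>a. ?v $ ?h a) = Z"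
        using Z block_index_less by (intro eq_matI) auto
      moreover have "0 \<le> Re (map_vec cnj ?v \<bullet> (?A *\<^sub>v ?v))"
        using * vec_carrier unfolding psd_def by (elim conjE) (erule bspec)
      ultimately show "0 \<le> Re (form Y X Z)"
        by (simp only: vec vec_carrier)
    qed
  next
    assume *: "\<forall>Z\<in>carrier_mat d n. 0 \<le> Re (form Y X Z)"
    show "psd (d * n) ?A"
      unfolding psd_def
    proof (intro conjI A ballI)
      fix v :: "complex vec" assume "v \<in> carrier_vec (d * n)"
      then show "0 \<le> Re (map_vec cnj v \<bullet> (?A *\<^sub>v v))"
        using * by (simp only: vec mat_carrier)
    qed
  qed
qed

section \<open>Matrix convexity and polarity\<close>

lemma SMall_iff:
  assumes "0 < g"
  shows "X \<in> SMall g \<longleftrightarrow> X \<in> SM (tdim X) g \<and> 1 \<le> tdim X"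
  using SM_tdim[OF _ assms] by (auto simp: SMall_def)

lemma mcomb_okD:
  assumes "mcomb_ok K n L" "K \<subseteq> SMall g" "0 < g" "(Y,V) \<in> set L"
  shows "Y \<in> K" "Y \<in> SM (tdim Y) g" "V \<in> carrier_mat (tdim Y) n"
  using assms SMall_iff[OF assms(3)] by (auto simp: mcomb_ok_def)

lemma mcomb_nth: "t < g \<Longrightarrow> mcomb g n L ! t = foldr (+) (map (\<lambda>(Y,V). adj V * (Y ! t) * V) L) (0\<^sub>m n n)"
  by (simp add: mcomb_def)

lemma congruence_carrier:
  "M \<in> carrier_mat m m \<Longrightarrow> V \<in> carrier_mat m n \<Longrightarrow> adj V * M * V \<in> carrier_mat n n"
  by (intro mult_carrier_mat[of _ n m] adj_carrier)

lemma adj_congruence: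
  assumes "M \<in> carrier_mat m m" "V \<in> carrier_mat m n"
  shows "adj (adj V * M * V) = adj V * adj M * V"
proof -
  note V' = adj_carrier[OF assms(2)]
  have "adj (adj V * M * V) = adj V * (adj M * V)"
    by (simp only: adj_mult[OF mult_carrier_mat[OF V' assms(1)] assms(2)] adj_mult[OF V' assms(1)] adj_adj)
  also have "\<dots> = adj V * adj M * V"
    by (rule assoc_mult_mat[OF V' adj_carrier[OF assms(1)] assms(2), symmetric])
  finally show ?thesis .
qed

lemma mcomb_SM:
  assumes "mcomb_ok K n L" "K \<subseteq> SMall g" "0 < g"
  shows "mcomb g n L \<in> SM n g"
proof -
  have "mcomb g n L ! t \<in> carrier_mat n n \<and> adj (mcomb g n L ! t) = mcomb g n L ! t" if "t < g" for t
  proof -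
    have "adj V * (Y ! t) * V \<in> carrier_mat n n" "adj (adj V * (Y ! t) * V) = adj V * (Y ! t) * V"
      if YV: "(Y,V) \<in> set L" for Y V
    proof -
      have c: "V \<in> carrier_mat (tdim Y) n" "Y ! t \<in> carrier_mat (tdim Y) (tdim Y)" "adj (Y ! t) = Y ! t"
        using mcomb_okD[OF assms YV] SM_carrier SM_adj \<open>t < g\<close> by auto
      then show "adj V * (Y ! t) * V \<in> carrier_mat n n"
        by auto
      show "adj (adj V * (Y ! t) * V) = adj V * (Y ! t) * V"
        using adj_congruence[OF c(2,1)] c(3) by simp
    qed
    then show ?thesis
      unfolding mcomb_nth[OF that] by (intro conjI foldr_mat_carrier foldr_mat_adj) auto
  qed
  then show ?thesis
    by (simp add: SM_def) (simp add: mcomb_def)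
qed

lemma sum_sum_list_swap:
  fixes f :: "'a \<Rightarrow> 'b \<Rightarrow> 'c :: comm_monoid_add"
  shows "(\<Sum>t\<in>A. \<Sum>x\<leftarrow>xs. f t x) = (\<Sum>x\<leftarrow>xs. \<Sum>t\<in>A. f t x)"
  by (induction xs) (simp_all add: sum.distrib)

text \<open>The term \<open>ip Z Z\<close> splits because the \<open>adj V * V\<close> add up to the
  identity, the other terms because of \<open>ip_congruence\<close>. Nonnegativity of the summands
  therefore passes to the combination, and conversely a zero of the total forces a zero of every
  nonnegative summand.\<close>

lemma form_mcomb:
  assumes "mcomb_ok K n L" "K \<subseteq> SMall g" "0 < g" "X \<in> SM m g" "Z \<in> carrier_mat n m"
  shows "form (mcomb g n L) X Z = (\<Sum>(Y,V)\<leftarrow>L. form Y X (V * Z))"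
proof -
  note L = mcomb_okD[OF assms(1-3)]
  have id: "ip Z Z = (\<Sum>(Y,V)\<leftarrow>L. ip (V * Z) (V * Z))"
  proof -
    have "ip Z Z = ip Z (foldr (+) (map (\<lambda>(Y,V). adj V * V) L) (0\<^sub>m n n) * Z * 1\<^sub>m m)"
      using assms(1,5) by (simp add: mcomb_ok_def)
    also have "\<dots> = (\<Sum>x\<leftarrow>L. ip Z ((case x of (Y,V) \<Rightarrow> adj V * V) * Z * 1\<^sub>m m))"
      using assms(5) by (intro ip_foldr) (auto intro!: mult_carrier_mat[OF adj_carrier] dest: L(3))
    also have "\<dots> = (\<Sum>(Y,V)\<leftarrow>L. ip (V * Z) (V * Z))"
    proof (intro arg_cong[of _ _ sum_list] map_cong refl, clarify)
      fix Y V assume "(Y,V) \<in> set L"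
      from L(3)[OF this] show "ip Z (adj V * V * Z * 1\<^sub>m m) = ip (V * Z) (V * Z)"
        using assms(5) ip_adj_mult[of V "tdim Y" n Z m "V * Z"] assoc_mult_mat[OF adj_carrier, of V "tdim Y" n V n Z m]
        by (simp add: right_mult_one_mat[of _ n m] mult_carrier_mat[of _ n n])
    qed
    finally show ?thesis .
  qed
  have t: "ip Z (mcomb g n L ! t * Z * transpose_mat (X ! t)) =
      (\<Sum>(Y,V)\<leftarrow>L. ip (V * Z) (Y ! t * (V * Z) * transpose_mat (X ! t)))" if "t < g" for t
  proof -
    have N: "transpose_mat (X ! t) \<in> carrier_mat m m"
      using SM_carrier[OF assms(4) that] by simp
    have c: "V \<in> carrier_mat (tdim Y) n" "Y ! t \<in> carrier_mat (tdim Y) (tdim Y)" if "(Y,V) \<in> set L" for Y V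
      using L[OF that] SM_carrier \<open>t < g\<close> by auto
    have "ip Z (mcomb g n L ! t * Z * transpose_mat (X ! t)) =
        (\<Sum>x\<leftarrow>L. ip Z ((case x of (Y,V) \<Rightarrow> adj V * (Y ! t) * V) * Z * transpose_mat (X ! t)))"
      unfolding mcomb_nth[OF that] using N assms(5)
      by (intro ip_foldr) (clarify, rule congruence_carrier, (rule c, assumption)+)
    also have "\<dots> = (\<Sum>(Y,V)\<leftarrow>L. ip (V * Z) (Y ! t * (V * Z) * transpose_mat (X ! t)))"
      by (intro arg_cong[of _ _ sum_list] map_cong refl)
        (clarify, rule ip_congruence[OF c N assms(5)])
    finally show ?thesis .
  qed
  have *: "(\<Sum>t<g. \<Sum>(Y,V)\<leftarrow>L. ip (V * Z) (Y ! t * (V * Z) * transpose_mat (X ! t))) =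
      (\<Sum>(Y,V)\<leftarrow>L. \<Sum>t<g. ip (V * Z) (Y ! t * (V * Z) * transpose_mat (X ! t)))"
    by (simp add: sum_sum_list_swap split_def)
  have "form (mcomb g n L) X Z = ip Z Z - (\<Sum>t<g. ip Z (mcomb g n L ! t * Z * transpose_mat (X ! t)))"
    by (simp add: form_def mcomb_def)
  also have "\<dots> = (\<Sum>(Y,V)\<leftarrow>L. ip (V * Z) (V * Z)) -
      (\<Sum>(Y,V)\<leftarrow>L. \<Sum>t<g. ip (V * Z) (Y ! t * (V * Z) * transpose_mat (X ! t)))"
    unfolding id *[symmetric] by (intro arg_cong2[of _ _ _ _ minus] sum.cong refl) (rule t, simp)
  also have "\<dots> = (\<Sum>(Y,V)\<leftarrow>L. form Y X (V * Z))"
    unfolding sum_list_subtractf[symmetric] form_def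
    by (intro arg_cong[of _ _ sum_list] map_cong refl) (auto simp: SM_length[OF L(2)])
  finally show ?thesis .
qed

lemma form_nonneg_commute:
  assumes "Y \<in> SM d g" "X \<in> SM n g"
  shows "(\<forall>Z\<in>carrier_mat d n. 0 \<le> Re (form Y X Z)) \<longleftrightarrow> (\<forall>Z\<in>carrier_mat n d. 0 \<le> Re (form X Y Z))"
proof -
  have "\<forall>Z\<in>carrier_mat n d. 0 \<le> Re (form X Y Z)"
    if "\<forall>Z\<in>carrier_mat d n. 0 \<le> Re (form Y X Z)" "Y \<in> SM d g" "X \<in> SM n g" for X Y d n
  proof
    fix Z :: "complex mat" assume "Z \<in> carrier_mat n d"
    then show "0 \<le> Re (form X Y Z)"
      using that form_commute[OF that(2,3), of "transpose_mat Z"] by simp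
  qed
  with assms show ?thesis
    by blast
qed

text \<open>In contrast to the pencil, the variable tuple \<open>X\<close> comes first here, since
  \<open>form_mcomb\<close> decomposes the first argument of \<open>form\<close>.\<close>

lemma free_spec_iff:
  assumes "A \<in> SM d g" "0 < g"
  shows "X \<in> free_spec d A \<longleftrightarrow> X \<in> SMall g \<and> (\<forall>Z\<in>carrier_mat (tdim X) d. 0 \<le> Re (form X A Z))"
proof -
  have "X \<in> free_spec d A \<longleftrightarrow> X \<in> SMall g \<and>
      psd (d * tdim X) (1\<^sub>m (d * tdim X) - pencil d (tdim X) A X)"
    using SM_tdim[OF _ assms(2)] SM_length[OF assms(1)] unfolding free_spec_def SMall_def by auto
  then show ?thesis
    using psd_pencil_iff[OF assms(1)] form_nonneg_commute[OF assms(1)] SMall_iff[OF assms(2)] by auto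
qed

lemma free_polar_iff:
  assumes "K \<subseteq> SMall g" "0 < g"
  shows "X \<in> free_polar g K \<longleftrightarrow> X \<in> SMall g \<and>
    (\<forall>Y\<in>K. \<forall>Z\<in>carrier_mat (tdim Y) (tdim X). 0 \<le> Re (form Y X Z))"
proof -
  have "X \<in> free_polar g K \<longleftrightarrow> X \<in> SMall g \<and>
      (\<forall>Y\<in>K. psd (tdim Y * tdim X) (1\<^sub>m (tdim Y * tdim X) - pencil (tdim Y) (tdim X) Y X))"
    using SM_tdim[OF _ assms(2)] unfolding free_polar_def SMall_def by auto
  moreover have "Y \<in> SM (tdim Y) g" if "Y \<in> K" for Y
    using that assms SMall_iff[OF assms(2)] by auto
  ultimately show ?thesis
    using psd_pencil_iff SMall_iff[OF assms(2)] by blast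
qed

text \<open>This set is the matrix analogue of a half-space with normal \<open>X\<close>. For a
  fixed \<open>X\<close> it is the free spectrahedron of \<open>X\<close>; for \<open>X\<close>
  ranging over a polar it is the test set that must swallow the whole convex hull.\<close>

lemma matrix_convex_form_nonneg:
  assumes "X \<in> SM m g" "0 < g"
  shows "matrix_convex g {Y \<in> SMall g. \<forall>Z\<in>carrier_mat (tdim Y) m. 0 \<le> Re (form Y X Z)}"
    (is "matrix_convex g ?K")
proof -
  have sub: "?K \<subseteq> SMall g"
    by blast
  have "mcomb g n L \<in> ?K" if ok: "mcomb_ok ?K n L" for n L
  proof -
    have mem: "mcomb g n L \<in> SM n g"
      using mcomb_SM[OF ok sub assms(2)] .
    have "0 \<le> Re (form (mcomb g n L) X Z)" if Z: "Z \<in> carrier_mat n m" for Z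
    proof -
      have "0 \<le> Re (form Y X (V * Z))" if "(Y,V) \<in> set L" for Y V
        using mcomb_okD[OF ok sub assms(2) that] Z by auto
      then have "\<forall>x\<in>set L. 0 \<le> Re (case x of (Y,V) \<Rightarrow> form Y X (V * Z))"
        by auto
      then have "0 \<le> Re (\<Sum>(Y,V)\<leftarrow>L. form Y X (V * Z))"
        by (induction L) auto
      then show ?thesis
        using form_mcomb[OF ok sub assms(2,1) Z] by simp
    qed
    moreover have "1 \<le> n"
      using ok by (simp add: mcomb_ok_def)
    ultimately show ?thesis
      using mem SM_tdim[OF mem assms(2)] by (auto simp: SMall_def)
  qed
  then show ?thesis
    using sub by (auto simp: matrix_convex_def)
qed

lemma matrix_convex_free_spec:
  assumes "A \<in> SM d g" "0 < g"
  shows "matrix_convex g (free_spec d A)"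
proof -
  have "free_spec d A = {X \<in> SMall g. \<forall>Z\<in>carrier_mat (tdim X) d. 0 \<le> Re (form X A Z)}"
    using free_spec_iff[OF assms] by blast
  then show ?thesis
    using matrix_convex_form_nonneg[OF assms] by simp
qed

lemma mconv_minimal: "matrix_convex g K \<Longrightarrow> S \<subseteq> K \<Longrightarrow> mconv g S \<subseteq> K"
  by (auto simp: mconv_def)

lemma mconv_mono: "S \<subseteq> T \<Longrightarrow> mconv g S \<subseteq> mconv g T"
  by (auto simp: mconv_def)

lemma mcomb_in_mconv:
  assumes "mcomb_ok S n L"
  shows "mcomb g n L \<in> mconv g S"
proof -
  have "mcomb_ok K n L" if "S \<subseteq> K" for K
    using assms that by (fastforce simp: mcomb_ok_def)
  then show ?thesis
    by (auto simp: mconv_def matrix_convex_def)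
qed

text \<open>Membership of \<open>A\<close> in its own spectrahedron permits testing a polar element
  on \<open>Y = A\<close>, which gives one inclusion. For the other, the half-space with normal
  \<open>X\<close> contains \<open>A\<close>, hence its hull, hence all of the
  spectrahedron.\<close>

lemma free_polar_eq_free_spec:
  assumes "A \<in> SM d g" "0 < g" "A \<in> free_spec d A" "free_spec d A \<subseteq> mconv g {A}"
  shows "free_polar g (free_spec d A) = free_spec d A"
proof -
  have sub: "free_spec d A \<subseteq> SMall g"
    using free_spec_iff[OF assms(1,2)] by blast
  have td: "tdim A = d"
    using SM_tdim assms(1,2) .
  show ?thesis
  proof (intro subset_antisym subsetI)
    fix X assume "X \<in> free_polar g (free_spec d A)"
    then have X: "X \<in> SMall g" "\<forall>Z\<in>carrier_mat d (tdim X). 0 \<le> Re (form A X Z)"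
      using free_polar_iff[OF sub assms(2)] assms(3) td by auto
    then show "X \<in> free_spec d A"
      using form_nonneg_commute[OF assms(1)] SMall_iff[OF assms(2)] free_spec_iff[OF assms(1,2)] by auto
  next
    fix X assume X: "X \<in> free_spec d A"
    then have XS: "X \<in> SMall g" "X \<in> SM (tdim X) g"
      using sub SMall_iff[OF assms(2)] by auto
    let ?K = "{Y \<in> SMall g. \<forall>Z\<in>carrier_mat (tdim Y) (tdim X). 0 \<le> Re (form Y X Z)}"
    have "A \<in> ?K"
      using X assms(3) sub td form_nonneg_commute[OF assms(1) XS(2)] free_spec_iff[OF assms(1,2)] by auto
    then have "mconv g {A} \<subseteq> ?K"
      using matrix_convex_form_nonneg[OF XS(2) assms(2)] by (intro mconv_minimal) auto
    then show "X \<in> free_polar g (free_spec d A)"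
      using XS(1) assms(4) free_polar_iff[OF sub assms(2)] by auto
  qed
qed

section \<open>Factorization of positive kernels\<close>

text \<open>A Cholesky decomposition by induction on the index set. Either the pivot at
  \<open>s\<close> vanishes, and positivity then kills its row and column, or one rank-one term is
  split off and the Schur complement remains.\<close>

lemma psd_kernel_factorization:
  fixes F :: "'a \<Rightarrow> 'a \<Rightarrow> complex"
  assumes "finite S" "\<And>a b. a \<in> S \<Longrightarrow> b \<in> S \<Longrightarrow> F b a = cnj (F a b)"
    and "\<And>c. 0 \<le> Re (\<Sum>a\<in>S. \<Sum>b\<in>S. cnj (c a) * F a b * c b)"
  shows "\<exists>rs. \<forall>a\<in>S. \<forall>b\<in>S. F a b = (\<Sum>r\<leftarrow>rs. cnj (r a) * r b)"
  using assms
proof (induction S arbitrary: F rule: finite_induct)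
  case empty
  then show ?case by simp
next
  case (insert s S)
  define row where "row c = (\<Sum>b\<in>S. F s b * c b)" for c
  define Q where "Q c = (\<Sum>a\<in>S. \<Sum>b\<in>S. cnj (c a) * F a b * c b)" for c
  define f where "f = Re (F s s)"
  have Fss: "F s s = of_real f"
    using insert.prems(1)[of s s] by (simp add: f_def complex_eq_iff)
  have herm: "F b a = cnj (F a b)" if "a \<in> insert s S" "b \<in> insert s S" for a b
    using insert.prems(1) that .
  have pos: "0 \<le> f * (cmod z)\<^sup>2 + 2 * Re (cnj z * row c) + Re (Q c)" for z c
  proof -
    \<comment> \<open>Complete the square: test positivity on \<open>c\<close> with a free value \<open>z\<close> at \<open>s\<close>.\<close>
    let ?c = "c(s := z)"
    have ne: "a \<noteq> s" if "a \<in> S" for a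
      using that insert.hyps by auto
    have "(\<Sum>a\<in>insert s S. \<Sum>b\<in>insert s S. cnj (?c a) * F a b * ?c b) =
        cnj z * F s s * z + (\<Sum>b\<in>S. cnj z * F s b * c b) +
        ((\<Sum>a\<in>S. cnj (c a) * F a s * z) + Q c)"
      using insert.hyps ne by (simp add: Q_def sum.distrib cong: sum.cong)
    also have "(\<Sum>b\<in>S. cnj z * F s b * c b) = cnj z * row c"
      by (simp add: row_def sum_distrib_left mult.assoc)
    also have "(\<Sum>a\<in>S. cnj (c a) * F a s * z) = cnj (cnj z * row c)"
      using herm[of s] by (simp add: row_def sum_distrib_left mult_ac)
    also have "cnj z * F s s * z = of_real (f * (cmod z)\<^sup>2)"
      using complex_norm_square[of z] by (simp add: Fss mult_ac)
    finally have "(\<Sum>a\<in>insert s S. \<Sum>b\<in>insert s S. cnj (?c a) * F a b * ?c b) =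
        of_real (f * (cmod z)\<^sup>2) + cnj z * row c + (cnj (cnj z * row c) + Q c)" .
    then show ?thesis
      using insert.prems(2)[of ?c] by simp
  qed
  show ?case
  proof (cases "f = 0")
    case True
    have zero: "F s a = 0" if a: "a \<in> S" for a
    proof (rule ccontr)
      assume nz: "F s a \<noteq> 0"
      let ?e = "\<lambda>b. if b = a then 1 else 0 :: complex"
      have row: "row ?e = F s a"
        using a insert.hyps by (simp add: row_def if_distrib cong: if_cong)
      \<comment> \<open>With pivot 0 the bound \<open>pos\<close> is affine along the line
        \<open>z = - K * F s a\<close>; this \<open>K\<close> is chosen so that its value is exactly
        -1.\<close>
      define K where "K = (Re (Q ?e) + 1) / (2 * (cmod (F s a))\<^sup>2)"
      have "Re (cnj (- of_real K * F s a) * F s a) = - K * (cmod (F s a))\<^sup>2"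
        unfolding cmod_power2 by (simp add: power2_eq_square algebra_simps)
      with pos[of "- of_real K * F s a" ?e] True row
      have "0 \<le> - (2 * K * (cmod (F s a))\<^sup>2) + Re (Q ?e)"
        by simp
      also have "2 * K * (cmod (F s a))\<^sup>2 = Re (Q ?e) + 1"
        using nz by (simp add: K_def)
      finally show False by simp
    qed
    have "0 \<le> Re (\<Sum>a\<in>S. \<Sum>b\<in>S. cnj (c a) * F a b * c b)" for c
      using pos[of 0 c] by (simp add: Q_def)
    then obtain rs where rs: "\<forall>a\<in>S. \<forall>b\<in>S. F a b = (\<Sum>r\<leftarrow>rs. cnj (r a) * r b)"
      using insert.IH[of F] herm by blast
    \<comment> \<open>The induction hypothesis says nothing about the values of the \<open>r\<close>
      at \<open>s\<close>. Resetting them to 0 reproduces the vanishing row and column.\<close>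
    have "F a b = (\<Sum>r\<leftarrow>map (\<lambda>r. r(s := 0)) rs. cnj (r a) * r b)" if ab: "a \<in> insert s S" "b \<in> insert s S" for a b
    proof (cases "a = s \<or> b = s")
      case True
      have "(\<Sum>r\<leftarrow>map (\<lambda>r. r(s := 0)) rs. cnj (r a) * r b) = 0"
        using True by (induction rs) auto
      moreover have "F a b = 0"
        using True ab zero herm[of s a] \<open>f = 0\<close> Fss by auto
      ultimately show ?thesis
        by simp
    next
      case False
      with ab rs show ?thesis
        by (simp add: o_def)
    qed
    then show ?thesis
      by blast
  next
    case False
    have f: "f > 0"
      using pos[of 1 "\<lambda>_. 0"] False by (simp add: row_def Q_def)
    define G where "G a b = F a b - F a s * F s b / of_real f" for a b
    have "0 \<le> Re (\<Sum>a\<in>S. \<Sum>b\<in>S. cnj (c a) * G a b * c b)" for c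
    proof -
      have "(\<Sum>a\<in>S. \<Sum>b\<in>S. cnj (c a) * G a b * c b) =
          Q c - (\<Sum>a\<in>S. cnj (c a) * F a s) * row c / of_real f"
        by (simp add: G_def Q_def row_def sum_product sum_subtractf sum_divide_distrib algebra_simps)
          (rule sum.swap)
      also have "(\<Sum>a\<in>S. cnj (c a) * F a s) = cnj (row c)"
        using herm[of s] by (simp add: row_def mult.commute)
      also have "cnj (row c) * row c = of_real ((cmod (row c))\<^sup>2)"
        using complex_norm_square[of "row c"] by (simp add: mult.commute)
      finally have "Re (\<Sum>a\<in>S. \<Sum>b\<in>S. cnj (c a) * G a b * c b) = Re (Q c) - (cmod (row c))\<^sup>2 / f"
        by (simp flip: of_real_power of_real_divide)
      \<comment> \<open>The point \<open>z = - row c / f\<close> minimizes the quadratic in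
        \<open>pos\<close>, and the minimum is the form of the Schur complement at
        \<open>c\<close>.\<close>
      moreover have "Re (cnj (- row c / of_real f) * row c) = - ((cmod (row c))\<^sup>2 / f)"
        unfolding cmod_power2 by (simp add: power2_eq_square add_divide_distrib diff_divide_distrib)
      moreover have "f * (cmod (- row c / of_real f))\<^sup>2 = (cmod (row c))\<^sup>2 / f"
        using f by (simp add: norm_divide power_divide power2_eq_square)
      ultimately show ?thesis
        using pos[of "- row c / of_real f" c] by linarith
    qed
    moreover have "G b a = cnj (G a b)" if "a \<in> S" "b \<in> S" for a b
      using that herm[of a b] herm[of a s] herm[of s b] by (simp add: G_def)
    ultimately obtain rs where rs: "\<forall>a\<in>S. \<forall>b\<in>S. G a b = (\<Sum>r\<leftarrow>rs. cnj (r a) * r b)"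
      using insert.IH[of G] by blast
    \<comment> \<open>\<open>G\<close> is the Schur complement of the entry at \<open>s\<close>; the missing rank-one term is \<open>?r\<close>.\<close>
    let ?r = "\<lambda>a. F s a / of_real (sqrt f)"
    have r: "cnj (?r a) * ?r b = F a s * F s b / of_real f" if "a \<in> insert s S" for a b
      using herm[of s a] that f by (simp flip: of_real_mult)
    have "F a b = (\<Sum>r\<leftarrow>?r # map (\<lambda>r. r(s := 0)) rs. cnj (r a) * r b)" if ab: "a \<in> insert s S" "b \<in> insert s S" for a b
    proof (cases "a = s \<or> b = s")
      case True
      have "(\<Sum>r\<leftarrow>map (\<lambda>r. r(s := 0)) rs. cnj (r a) * r b) = 0"
        using True by (induction rs) auto
      then show ?thesis
        using True f r[OF ab(1), of b] by (auto simp: Fss)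
    next
      case False
      then have "G a b = (\<Sum>r\<leftarrow>map (\<lambda>r. r(s := 0)) rs. cnj (r a) * r b)"
        using ab rs by (simp add: o_def)
      moreover have "F a b = F a s * F s b / of_real f + G a b"
        by (simp add: G_def)
      ultimately show ?thesis
        by (simp only: list.map sum_list.Cons r[OF ab(1)])
    qed
    then show ?thesis
      by blast
  qed
qed

lemma SM_index_cnj:
  assumes "X \<in> SM n g" "t < g" "p < n" "q < n"
  shows "X ! t $$ (q,p) = cnj (X ! t $$ (p,q))"
  using arg_cong[OF SM_adj[OF assms(1,2)], of "\<lambda>M. M $$ (q,p)"] SM_carrier[OF assms(1,2)] assms(3,4)
  by simp

lemma pencil_kernel_factorization:
  assumes "Y \<in> SM d g" "X \<in> SM n g" "\<forall>Z\<in>carrier_mat d n. 0 \<le> Re (form Y X Z)"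
  shows "\<exists>rs. \<forall>a\<in>{..<d} \<times> {..<n}. \<forall>b\<in>{..<d} \<times> {..<n}.
    pencil_kernel Y X a b = (\<Sum>r\<leftarrow>rs. cnj (r a) * r b)"
proof (rule psd_kernel_factorization)
  let ?S = "{..<d} \<times> {..<n}"
  show "finite ?S"
    by simp
  show "pencil_kernel Y X b a = cnj (pencil_kernel Y X a b)" if "a \<in> ?S" "b \<in> ?S" for a b
    unfolding pencil_kernel_def SM_length[OF assms(1)]
    using that SM_index_cnj[OF assms(1), of _ "fst a" "fst b"] SM_index_cnj[OF assms(2), of _ "snd a" "snd b"]
    by (auto simp: of_bool_def intro!: sum.cong)
  show "0 \<le> Re (\<Sum>a\<in>?S. \<Sum>b\<in>?S. cnj (c a) * pencil_kernel Y X a b * c b)" for c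
  proof -
    have "(\<Sum>a\<in>?S. \<Sum>b\<in>?S. cnj (c a) * pencil_kernel Y X a b * c b) = form Y X (mat d n c)"
      unfolding form_expand[OF assms(1,2) mat_carrier] by (intro sum.cong refl) auto
    then show ?thesis
      using assms(3) by simp
  qed
qed

text \<open>A positive form is zero only at null vectors of its matrix. By the factorization it is
  the sum of the squares \<open>(cmod (h r))\<^sup>2\<close>, so all \<open>h r\<close> vanish, and
  each entry of matrix times vector is a linear combination of the \<open>h r\<close>.\<close>

lemma pencil_kernel_null:
  assumes "Y \<in> SM d g" "X \<in> SM n g" "\<forall>Z\<in>carrier_mat d n. 0 \<le> Re (form Y X Z)"
    and "Z \<in> carrier_mat d n" "Re (form Y X Z) = 0" "a \<in> {..<d} \<times> {..<n}"
  shows "(\<Sum>b\<in>{..<d} \<times> {..<n}. pencil_kernel Y X a b * Z $$ b) = 0"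
proof -
  let ?S = "{..<d} \<times> {..<n}"
  obtain rs where rs: "\<forall>a\<in>?S. \<forall>b\<in>?S. pencil_kernel Y X a b = (\<Sum>r\<leftarrow>rs. cnj (r a) * r b)"
    using pencil_kernel_factorization[OF assms(1-3)] by blast
  define h where "h r = (\<Sum>b\<in>?S. r b * Z $$ b)" for r :: "nat \<times> nat \<Rightarrow> complex"
  have row: "(\<Sum>b\<in>?S. pencil_kernel Y X a b * Z $$ b) = (\<Sum>r\<leftarrow>rs. cnj (r a) * h r)" if "a \<in> ?S" for a
  proof -
    have "(\<Sum>b\<in>?S. pencil_kernel Y X a b * Z $$ b) = (\<Sum>b\<in>?S. \<Sum>r\<leftarrow>rs. cnj (r a) * (r b * Z $$ b))"
      by (intro sum.cong refl)
        (simp only: rs[rule_format, OF that] sum_list_mult_const[symmetric] mult.assoc)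
    also have "\<dots> = (\<Sum>r\<leftarrow>rs. cnj (r a) * h r)"
      by (simp add: sum_sum_list_swap h_def sum_distrib_left)
    finally show ?thesis .
  qed
  have "form Y X Z = (\<Sum>a\<in>?S. cnj (Z $$ a) * (\<Sum>b\<in>?S. pencil_kernel Y X a b * Z $$ b))"
    unfolding form_expand[OF assms(1,2,4)] by (simp only: sum_distrib_left mult.assoc)
  also have "\<dots> = (\<Sum>a\<in>?S. \<Sum>r\<leftarrow>rs. cnj (r a * Z $$ a) * h r)"
  proof (rule sum.cong[OF refl])
    fix a assume "a \<in> ?S"
    show "cnj (Z $$ a) * (\<Sum>b\<in>?S. pencil_kernel Y X a b * Z $$ b) = (\<Sum>r\<leftarrow>rs. cnj (r a * Z $$ a) * h r)"
      unfolding row[OF \<open>a \<in> ?S\<close>] by (simp add: mult_ac flip: sum_list_const_mult)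
  qed
  also have "\<dots> = (\<Sum>r\<leftarrow>rs. cnj (h r) * h r)"
    by (simp add: sum_sum_list_swap h_def sum_distrib_right)
  also have "\<dots> = (\<Sum>r\<leftarrow>rs. of_real ((cmod (h r))\<^sup>2))"
    by (simp only: complex_norm_square mult.commute)
  finally have "form Y X Z = of_real (\<Sum>r\<leftarrow>rs. (cmod (h r))\<^sup>2)"
    using sum_list_of_real[of "map (\<lambda>r. (cmod (h r))\<^sup>2) rs", where ?'a = complex] by (simp add: o_def)
  with assms(5) have "(\<Sum>r\<leftarrow>rs. (cmod (h r))\<^sup>2) = 0"
    by simp
  then have "h r = 0" if "r \<in> set rs" for r
    using that by (subst (asm) sum_list_nonneg_eq_0_iff) auto
  then show ?thesis
    unfolding row[OF assms(6)] by (auto intro!: sum_list_0 cong: map_cong)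
qed

section \<open>The Pauli tuple\<close>

lemma lessThan_2: "{..<2::nat} = {0, 1}" and lessThan_3: "{..<3::nat} = {0, 1, 2}"
  by auto

lemma pauli_length [simp]: "length pauli = 3"
  by (simp add: pauli_def)

lemma pauli_nth:
  "pauli ! 0 = mat_of_rows_list 2 [[1, 0], [0, -1]]"
  "pauli ! Suc 0 = mat_of_rows_list 2 [[0, 1], [1, 0]]"
  "pauli ! 2 = mat_of_rows_list 2 [[0, \<i>], [-\<i>, 0]]"
  by (simp_all add: pauli_def)

lemma pauli_index [simp]:
  "pauli ! 0 $$ (0, 0) = 1" "pauli ! 0 $$ (0, Suc 0) = 0"
  "pauli ! 0 $$ (Suc 0, 0) = 0" "pauli ! 0 $$ (Suc 0, Suc 0) = -1"
  "pauli ! Suc 0 $$ (0, 0) = 0" "pauli ! Suc 0 $$ (0, Suc 0) = 1"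
  "pauli ! Suc 0 $$ (Suc 0, 0) = 1" "pauli ! Suc 0 $$ (Suc 0, Suc 0) = 0"
  "pauli ! 2 $$ (0, 0) = 0" "pauli ! 2 $$ (0, Suc 0) = \<i>"
  "pauli ! 2 $$ (Suc 0, 0) = -\<i>" "pauli ! 2 $$ (Suc 0, Suc 0) = 0"
  by (simp_all add: pauli_nth mat_of_rows_list_def)

lemma pauli_SM: "pauli \<in> SM 2 3"
proof -
  have "pauli ! t \<in> carrier_mat 2 2 \<and> adj (pauli ! t) = pauli ! t" if "t \<in> {0, 1, 2}" for t
  proof
    show c: "pauli ! t \<in> carrier_mat 2 2"
      using that by (auto simp: pauli_nth mat_of_rows_list_def)
    show "adj (pauli ! t) = pauli ! t"
      using that c by (intro eq_matI) (auto simp: less_2_cases_iff)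
  qed
  then show ?thesis
    by (auto simp: SM_def less_Suc_eq numeral_3_eq_3 numeral_2_eq_2)
qed

lemma pauli_tdim: "tdim pauli = 2"
  using SM_tdim[OF pauli_SM] by simp

lemma pauli_SMall: "pauli \<in> SMall 3"
  using pauli_SM SMall_iff[of 3 pauli] by (simp add: pauli_tdim)

lemma sum_2_times_2:
  "(\<Sum>a\<in>{..<2::nat} \<times> {..<2::nat}. f a) = f (0,0) + f (0,Suc 0) + (f (Suc 0,0) + f (Suc 0,Suc 0))"
  for f :: "nat \<times> nat \<Rightarrow> 'a :: comm_monoid_add"
  by (simp add: sum.cartesian_product' lessThan_2 add.assoc)

lemma pencil_kernel_pauli:
  "pencil_kernel pauli X (0,p) (0,q) = of_bool (p = q) - X ! 0 $$ (p,q)"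
  "pencil_kernel pauli X (Suc 0,p) (Suc 0,q) = of_bool (p = q) + X ! 0 $$ (p,q)"
  "pencil_kernel pauli X (0,p) (Suc 0,q) = - (X ! Suc 0 $$ (p,q) + \<i> * X ! 2 $$ (p,q))"
  "pencil_kernel pauli X (Suc 0,p) (0,q) = - (X ! Suc 0 $$ (p,q) - \<i> * X ! 2 $$ (p,q))"
  by (simp_all add: pencil_kernel_def lessThan_3)

text \<open>Here \<open>I - sum P_j \<otimes> P_j\<close> is 2 (I - SWAP), and SWAP acts on a test
  matrix by transposition. So the form is the squared norm of \<open>Z\<close> minus its transpose.
  This puts P into its own spectrahedron and identifies the null space as the symmetric
  matrices.\<close>

lemma form_pauli_pauli:
  assumes "Z \<in> carrier_mat 2 2"
  shows "form pauli pauli Z = 2 * of_real ((cmod (Z $$ (0,1) - Z $$ (1,0)))\<^sup>2)"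
  unfolding form_expand[OF pauli_SM pauli_SM assms] complex_norm_square
  by (simp add: sum_2_times_2 pencil_kernel_pauli algebra_simps)

lemma pauli_in_free_spec: "pauli \<in> free_spec 2 pauli"
  using free_spec_iff[OF pauli_SM, of pauli] pauli_SMall
  by (auto simp: pauli_tdim form_pauli_pauli simp del: of_real_power)

lemma form_pauli_nonneg:
  assumes "X \<in> SM n 3" "X \<in> free_spec 2 pauli"
  shows "\<forall>Z\<in>carrier_mat 2 n. 0 \<le> Re (form pauli X Z)"
  using assms(2) free_spec_iff[OF pauli_SM] SM_tdim[OF assms(1)] form_nonneg_commute[OF pauli_SM assms(1)]
  by simp

text \<open>Choi's argument: every rank-one term of the kernel becomes one Kraus operator. That the
  map fixes I yields the normalization, that it sends P_t to X_t yields the combination. The list is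
  finite, so no closure of the hull is involved.\<close>

lemma free_spec_pauli_kraus:
  assumes "X \<in> SM n 3" "1 \<le> n" "X \<in> free_spec 2 pauli"
  obtains Vs where "mcomb_ok {pauli} n (map (Pair pauli) Vs)" "X = mcomb 3 n (map (Pair pauli) Vs)"
proof -
  let ?S = "{..<2::nat} \<times> {..<n}"
  let ?F = "pencil_kernel pauli X"
  have X: "X ! t \<in> carrier_mat n n" if "t < 3" for t
    using SM_carrier[OF assms(1) that] .
  obtain rs where rs: "\<forall>a\<in>?S. \<forall>b\<in>?S. ?F a b = (\<Sum>r\<leftarrow>rs. cnj (r a) * r b)"
    using pencil_kernel_factorization[OF pauli_SM assms(1) form_pauli_nonneg[OF assms(1,3)]] by blast
  \<comment> \<open>The Choi matrix is half the pencil conjugated by the singlet matrix, which swaps the rows of \<open>r\<close> and negates one.\<close>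
  define V where "V r = mat 2 n (\<lambda>(i,p). if i = 0 then r (1,p) / sqrt 2 else - r (0,p) / sqrt 2)"
    for r :: "nat \<times> nat \<Rightarrow> complex"
  have V: "V r \<in> carrier_mat 2 n" for r
    by (simp add: V_def)
  have half: "x / complex_of_real (sqrt 2) * (y / complex_of_real (sqrt 2)) = x * y / 2" for x y
    by (simp flip: of_real_mult)
  have VV: "cnj (V r $$ (0,p)) * V r $$ (0,q) = cnj (r (1,p)) * r (1,q) / 2"
    "cnj (V r $$ (0,p)) * V r $$ (1,q) = - (cnj (r (1,p)) * r (0,q) / 2)"
    "cnj (V r $$ (1,p)) * V r $$ (0,q) = - (cnj (r (0,p)) * r (1,q) / 2)"
    "cnj (V r $$ (1,p)) * V r $$ (1,q) = cnj (r (0,p)) * r (0,q) / 2" if "p < n" "q < n" for r p q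
    using that half by (simp_all add: V_def)
  \<comment> \<open>These are the images of the four matrix units under the map, entrywise: for
    instance E_00 = (I + P_1)/2 goes to (I + X_1)/2, and E_01 = (P_2 - i P_3)/2 goes to (X_2 - i
    X_3)/2.\<close>
  have VVs: "(\<Sum>r\<leftarrow>rs. cnj (V r $$ (0,p)) * V r $$ (0,q)) = ?F (1,p) (1,q) / 2"
    "(\<Sum>r\<leftarrow>rs. cnj (V r $$ (0,p)) * V r $$ (1,q)) = - (?F (1,p) (0,q) / 2)"
    "(\<Sum>r\<leftarrow>rs. cnj (V r $$ (1,p)) * V r $$ (0,q)) = - (?F (0,p) (1,q) / 2)"
    "(\<Sum>r\<leftarrow>rs. cnj (V r $$ (1,p)) * V r $$ (1,q)) = ?F (0,p) (0,q) / 2" if "p < n" "q < n" for p q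
    using rs that
    by (simp_all only: VV[OF that] uminus_sum_list_map[unfolded o_def, symmetric] divide_inverse sum_list_mult_const)
      auto
  let ?L = "map (Pair pauli) (map V rs)"
  have one: "foldr (+) (map (\<lambda>(Y,W). adj W * W) ?L) (0\<^sub>m n n) = 1\<^sub>m n"
  proof -
    have c: "adj (V r) * V r \<in> carrier_mat n n" for r
      using V by (intro mult_carrier_mat[of _ n 2] adj_carrier)
    have "foldr (+) (map (\<lambda>r. adj (V r) * V r) rs) (0\<^sub>m n n) $$ (p,q) = of_bool (p = q)"
      if "p < n" "q < n" for p q
    proof -
      have "foldr (+) (map (\<lambda>r. adj (V r) * V r) rs) (0\<^sub>m n n) $$ (p,q) =
          (\<Sum>r\<leftarrow>rs. (adj (V r) * V r) $$ (p,q))"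
        using c that by (intro foldr_mat_index)
      also have "\<dots> = (\<Sum>r\<leftarrow>rs. cnj (V r $$ (0,p)) * V r $$ (0,q) + cnj (V r $$ (1,p)) * V r $$ (1,q))"
        using V[of _] that carrier_matD[OF V]
        by (simp add: mult_index_sum[OF adj_carrier[OF V] V] lessThan_2 del: index_mult_mat(1))
      also have "\<dots> = of_bool (p = q)"
        unfolding sum_list_addf VVs[OF that] by (simp add: pencil_kernel_pauli field_simps)
      finally show ?thesis .
    qed
    moreover have "foldr (+) (map (\<lambda>r. adj (V r) * V r) rs) (0\<^sub>m n n) \<in> carrier_mat n n"
      using c by (intro foldr_mat_carrier)
    ultimately show ?thesis
      by (intro eq_matI) (auto simp: o_def)
  qed
  have ne: "rs \<noteq> []"
  proof
    assume "rs = []"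
    with one have "(0\<^sub>m n n :: complex mat) $$ (0,0) = 1\<^sub>m n $$ (0,0)"
      by simp
    with assms(2) show False
      by simp
  qed
  have "mcomb_ok {pauli} n ?L"
    unfolding mcomb_ok_def using one ne V assms(2) by (auto simp: pauli_tdim)
  moreover have "X = mcomb 3 n ?L"
  proof (rule nth_equalityI)
    show "length X = length (mcomb 3 n ?L)"
      using SM_length[OF assms(1)] by (simp add: mcomb_def)
    fix t assume "t < length X"
    then have t: "t < 3"
      using SM_length[OF assms(1)] by simp
    have P: "pauli ! t \<in> carrier_mat 2 2"
      using SM_carrier[OF pauli_SM t] .
    have e: "mcomb 3 n ?L ! t = foldr (+) (map (\<lambda>r. adj (V r) * (pauli ! t) * V r) rs) (0\<^sub>m n n)"
      using t by (simp add: mcomb_nth o_def)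
    have c: "adj (V r) * (pauli ! t) * V r \<in> carrier_mat n n" for r
      using P V by (rule congruence_carrier)
    show "X ! t = mcomb 3 n ?L ! t"
      unfolding e
    proof (rule eq_matI)
      have "foldr (+) (map (\<lambda>r. adj (V r) * (pauli ! t) * V r) rs) (0\<^sub>m n n) \<in> carrier_mat n n"
        using c by (intro foldr_mat_carrier)
      then show "dim_row (X ! t) = dim_row (foldr (+) (map (\<lambda>r. adj (V r) * (pauli ! t) * V r) rs) (0\<^sub>m n n))"
        "dim_col (X ! t) = dim_col (foldr (+) (map (\<lambda>r. adj (V r) * (pauli ! t) * V r) rs) (0\<^sub>m n n))"
        using X[OF t] by auto
      then have dims: "dim_row (foldr (+) (map (\<lambda>r. adj (V r) * (pauli ! t) * V r) rs) (0\<^sub>m n n)) = n"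
        "dim_col (foldr (+) (map (\<lambda>r. adj (V r) * (pauli ! t) * V r) rs) (0\<^sub>m n n)) = n"
        using X[OF t] by auto
      fix p q
      assume "p < dim_row (foldr (+) (map (\<lambda>r. adj (V r) * (pauli ! t) * V r) rs) (0\<^sub>m n n))"
        "q < dim_col (foldr (+) (map (\<lambda>r. adj (V r) * (pauli ! t) * V r) rs) (0\<^sub>m n n))"
      then have pq: "p < n" "q < n"
        using dims by auto
      have "foldr (+) (map (\<lambda>r. adj (V r) * (pauli ! t) * V r) rs) (0\<^sub>m n n) $$ (p,q) =
          (\<Sum>r\<leftarrow>rs. (adj (V r) * (pauli ! t) * V r) $$ (p,q))"
        using c pq by (intro foldr_mat_index)
      also have "\<dots> = (\<Sum>r\<leftarrow>rs.
          pauli ! t $$ (0,0) * (cnj (V r $$ (0,p)) * V r $$ (0,q)) +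
          pauli ! t $$ (1,0) * (cnj (V r $$ (1,p)) * V r $$ (0,q)) +
          (pauli ! t $$ (0,1) * (cnj (V r $$ (0,p)) * V r $$ (1,q)) +
          pauli ! t $$ (1,1) * (cnj (V r $$ (1,p)) * V r $$ (1,q))))"
        by (simp only: triple_index_sum[OF V P V pq]) (simp add: lessThan_2 mult_ac)
      also have "\<dots> = pauli ! t $$ (0,0) * (?F (1,p) (1,q) / 2) + pauli ! t $$ (1,0) * - (?F (0,p) (1,q) / 2) +
          (pauli ! t $$ (0,1) * - (?F (1,p) (0,q) / 2) + pauli ! t $$ (1,1) * (?F (0,p) (0,q) / 2))"
        unfolding sum_list_addf sum_list_const_mult VVs[OF pq] ..
      also have "\<dots> = X ! t $$ (p,q)"
      proof -
        have "t = 0 \<or> t = Suc 0 \<or> t = 2"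
          using t by auto
        then show ?thesis
          by (auto simp: pencil_kernel_pauli field_simps)
      qed
      finally show "X ! t $$ (p,q) =
          foldr (+) (map (\<lambda>r. adj (V r) * (pauli ! t) * V r) rs) (0\<^sub>m n n) $$ (p,q)"
        by simp
    qed
  qed
  ultimately show ?thesis
    using that by blast
qed

lemma free_spec_pauli_subset_mconv: "free_spec 2 pauli \<subseteq> mconv 3 {pauli}"
proof
  fix X assume X: "X \<in> free_spec 2 pauli"
  then obtain n where "X \<in> SM n 3" "1 \<le> n"
    by (auto simp: free_spec_def)
  with X obtain Vs where "mcomb_ok {pauli} n (map (Pair pauli) Vs)" "X = mcomb 3 n (map (Pair pauli) Vs)"
    by (elim free_spec_pauli_kraus)
  then show "X \<in> mconv 3 {pauli}"
    by (simp only: mcomb_in_mconv)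
qed

lemma mconv_pauli: "mconv 3 {pauli} = free_spec 2 pauli"
  using free_spec_pauli_subset_mconv pauli_in_free_spec
  by (intro subset_antisym mconv_minimal matrix_convex_free_spec[OF pauli_SM]) auto

lemma free_polar_pauli: "free_polar 3 (free_spec 2 pauli) = free_spec 2 pauli"
  by (rule free_polar_eq_free_spec[OF pauli_SM _ pauli_in_free_spec free_spec_pauli_subset_mconv]) simp

section \<open>Isometries and reducing subspaces\<close>

lemma unitary_congruence_cancel:
  assumes "unitary n U" "M \<in> carrier_mat n n"
  shows "U * (adj U * M * U) * adj U = M"
proof -
  have U: "U \<in> carrier_mat n n" "adj U \<in> carrier_mat n n" "U * adj U = 1\<^sub>m n"
    using assms(1) by (simp_all add: unitary_def)
  have "U * (adj U * M * U) = U * (adj U * (M * U))"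
    using assoc_mult_mat[OF U(2) assms(2) U(1)] by simp
  also have "\<dots> = (U * adj U) * (M * U)"
    by (rule assoc_mult_mat[OF U(1,2) mult_carrier_mat[OF assms(2) U(1)], symmetric])
  also have "\<dots> = M * U"
    using U assms(2) by simp
  finally show ?thesis
    using assoc_mult_mat[OF assms(2) U(1,2)] U(3) assms(2) by simp
qed

lemma uequiv_sym:
  assumes "X \<in> SM n g" "Y \<in> SM n g" "0 < g" "uequiv X Y"
  shows "uequiv Y X"
proof -
  have len: "length X = g" "length Y = g" "tdim X = n" "tdim Y = n"
    using assms SM_length SM_tdim by blast+
  obtain U where U: "unitary n U" "\<And>j. j < g \<Longrightarrow> X ! j = adj U * (Y ! j) * U"
    using assms(4) len by (auto simp: uequiv_def)
  then have Uc: "U \<in> carrier_mat n n" "adj U \<in> carrier_mat n n" and UU: "U * adj U = 1\<^sub>m n"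
    by (simp_all add: unitary_def)
  have "Y ! j = adj (adj U) * (X ! j) * adj U" if "j < g" for j
  proof -
    have Y: "Y ! j \<in> carrier_mat n n"
      using SM_carrier[OF assms(2) that] .
    show ?thesis
      unfolding U(2)[OF that] using unitary_congruence_cancel[OF U(1) Y] by simp
  qed
  moreover have "unitary n (adj U)"
    using U(1) by (simp add: unitary_def)
  ultimately show ?thesis
    unfolding uequiv_def len by blast
qed

text \<open>Zero rows pad \<open>A\<close> to a square matrix \<open>B\<close>; row \<open>r\<close>
  of \<open>B\<close> exists because \<open>r < n\<close> and is zero, so \<open>B\<close> is
  singular.\<close>

lemma kernel_vector_exists:
  fixes A :: "complex mat"
  assumes "A \<in> carrier_mat r n" "r < n"
  shows "\<exists>v\<in>carrier_vec n. v \<noteq> 0\<^sub>v n \<and> A *\<^sub>v v = 0\<^sub>v r"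
proof -
  define B where "B = mat n n (\<lambda>(i,j). if i < r then A $$ (i,j) else 0)"
  have B: "B \<in> carrier_mat n n"
    by (simp add: B_def)
  have "mat\<^sub>r n n (\<lambda>i. if i = r then 0\<^sub>v n else row B i) = B"
    using assms by (intro eq_matI) (auto simp: B_def)
  moreover have "det (mat\<^sub>r n n (\<lambda>i. if i = r then 0\<^sub>v n else row B i)) = 0"
    using B by (intro det_row_0 assms(2)) auto
  ultimately have "det B = 0"
    by simp
  then obtain v where v: "v \<in> carrier_vec n" "v \<noteq> 0\<^sub>v n" "B *\<^sub>v v = 0\<^sub>v n"
    using det_0_iff_vec_prod_zero[OF B] by blast
  have "A *\<^sub>v v = 0\<^sub>v r"
  proof (rule eq_vecI)
    fix i assume "i < dim_vec (0\<^sub>v r :: complex vec)"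
    then have i: "i < r" "i < n"
      using assms by auto
    have "row A i = row B i"
      using assms i by (intro eq_vecI) (auto simp: B_def)
    then show "(A *\<^sub>v v) $ i = 0\<^sub>v r $ i"
      using arg_cong[OF v(3), of "\<lambda>w. w $ i"] i assms B by simp
  qed (use assms in simp)
  with v show ?thesis
    by blast
qed

definition isometry :: "nat \<Rightarrow> nat \<Rightarrow> complex mat \<Rightarrow> bool" where
  "isometry n k S \<longleftrightarrow> S \<in> carrier_mat n k \<and> adj S * S = 1\<^sub>m k"

lemma isometry_index:
  assumes "S \<in> carrier_mat n k"
  shows "isometry n k S \<longleftrightarrow>
    (\<forall>i<k. \<forall>j<k. (\<Sum>a<n. cnj (S $$ (a,i)) * S $$ (a,j)) = of_bool (i = j))"
proof -
  have e: "(adj S * S) $$ (i,j) = (\<Sum>a<n. cnj (S $$ (a,i)) * S $$ (a,j))" if "i < k" "j < k" for i j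
    using assms that by (simp add: mult_index_sum[OF adj_carrier[OF assms] assms] del: index_mult_mat(1))
  have "adj S * S = 1\<^sub>m k" if "\<forall>i<k. \<forall>j<k. (\<Sum>a<n. cnj (S $$ (a,i)) * S $$ (a,j)) = of_bool (i = j)"
    using assms that e by (intro eq_matI) (auto simp del: index_mult_mat(1))
  moreover have "\<forall>i<k. \<forall>j<k. (\<Sum>a<n. cnj (S $$ (a,i)) * S $$ (a,j)) = of_bool (i = j)" if "adj S * S = 1\<^sub>m k"
    using e that by (auto simp flip: e)
  ultimately show ?thesis
    using assms by (auto simp: isometry_def)
qed

lemma isometry_dim_le:
  assumes "isometry n k S"
  shows "k \<le> n"
proof (rule ccontr)
  assume "\<not> k \<le> n"
  then obtain v where v: "v \<in> carrier_vec k" "v \<noteq> 0\<^sub>v k" "S *\<^sub>v v = 0\<^sub>v n"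
    using assms kernel_vector_exists[of S n k] by (auto simp: isometry_def)
  have S: "S \<in> carrier_mat n k" "adj S \<in> carrier_mat k n" "adj S * S = 1\<^sub>m k"
    using assms by (auto simp: isometry_def)
  have "v = (adj S * S) *\<^sub>v v"
    using S v by simp
  also have "\<dots> = adj S *\<^sub>v (S *\<^sub>v v)"
    by (rule assoc_mult_mat_vec[OF S(2,1) v(1)])
  also have "\<dots> = 0\<^sub>v k"
    using S v(3) by (intro eq_vecI) (auto simp: scalar_prod_def)
  finally show False
    using v by simp
qed

text \<open>A unit vector orthogonal to the columns of \<open>S\<close> is a normalized kernel
  vector of \<open>adj S\<close>, which has fewer rows than columns.\<close>

lemma isometry_extend:
  assumes "isometry n k S" "k < n"
  obtains S' where "isometry n (Suc k) S'" "\<And>i j. i < n \<Longrightarrow> j < k \<Longrightarrow> S' $$ (i,j) = S $$ (i,j)"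
proof -
  have S: "S \<in> carrier_mat n k"
    using assms by (simp add: isometry_def)
  obtain v where v: "v \<in> carrier_vec n" "v \<noteq> 0\<^sub>v n" "adj S *\<^sub>v v = 0\<^sub>v k"
    using kernel_vector_exists[OF adj_carrier[OF S] assms(2)] by blast
  define s where "s = (\<Sum>a<n. (cmod (v $ a))\<^sup>2)"
  have "s \<noteq> 0"
  proof
    assume "s = 0"
    then have "\<forall>a<n. v $ a = 0"
      by (auto simp: s_def sum_nonneg_eq_0_iff)
    with v show False
      by (metis carrier_vecD eq_vecI index_zero_vec)
  qed
  then have s: "s > 0"
    by (metis s_def less_eq_real_def sum_nonneg zero_le_power2)
  define u where "u a = v $ a / of_real (sqrt s)" for a
  have uu: "(\<Sum>a<n. cnj (u a) * u a) = 1"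
  proof -
    have "(\<Sum>a<n. cnj (u a) * u a) = (\<Sum>a<n. of_real ((cmod (v $ a))\<^sup>2) / of_real s)"
      using s unfolding complex_norm_square
      by (intro sum.cong refl) (simp add: u_def mult.commute flip: of_real_mult)
    also have "\<dots> = 1"
      using \<open>s \<noteq> 0\<close> by (simp add: s_def flip: sum_divide_distrib of_real_sum of_real_power)
    finally show ?thesis .
  qed
  have Su: "(\<Sum>a<n. cnj (S $$ (a,i)) * u a) = 0" if "i < k" for i
  proof -
    have "(\<Sum>a<n. cnj (S $$ (a,i)) * v $ a) = 0"
      using arg_cong[OF v(3), of "\<lambda>w. w $ i"] that S v(1) by (simp add: scalar_prod_def atLeast0LessThan)
    then show ?thesis
      by (simp add: u_def flip: sum_divide_distrib)
  qed
  have uS: "(\<Sum>a<n. cnj (u a) * S $$ (a,i)) = 0" if "i < k" for i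
    using arg_cong[OF Su[OF that], of cnj] by (simp add: mult.commute)
  define S' where "S' = mat n (Suc k) (\<lambda>(i,j). if j < k then S $$ (i,j) else u i)"
  have "isometry n (Suc k) S'"
  proof (subst isometry_index)
    show "\<forall>i<Suc k. \<forall>j<Suc k. (\<Sum>a<n. cnj (S' $$ (a,i)) * S' $$ (a,j)) = of_bool (i = j)"
      using assms(1) uu Su uS unfolding isometry_index[OF S] by (auto simp: S'_def less_Suc_eq)
  qed (simp add: S'_def)
  moreover have "S' $$ (i,j) = S $$ (i,j)" if "i < n" "j < k" for i j
    using that by (simp add: S'_def)
  ultimately show ?thesis
    using that by blast
qed

text \<open>Columns are appended one at a time; once the matrix is square, its left inverse is also
  a right inverse.\<close>

lemma isometry_complete_to_unitary:
  assumes "isometry n k S"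
  shows "\<exists>W. unitary n W \<and> (\<forall>i<n. \<forall>j<k. W $$ (i,j) = S $$ (i,j))"
  using assms
proof (induction "n - k" arbitrary: k S)
  case 0
  then have "k = n"
    using isometry_dim_le by fastforce
  with 0 have S: "S \<in> carrier_mat n n" "adj S * S = 1\<^sub>m n"
    by (auto simp: isometry_def)
  then have "S * adj S = 1\<^sub>m n"
    using mat_mult_left_right_inverse[OF adj_carrier[OF S(1)] S(1)] by simp
  with S show ?case
    by (auto simp: unitary_def)
next
  case (Suc m)
  then obtain S' where S': "isometry n (Suc k) S'" "\<And>i j. i < n \<Longrightarrow> j < k \<Longrightarrow> S' $$ (i,j) = S $$ (i,j)"
    using isometry_extend[OF Suc.prems] by (metis zero_less_Suc zero_less_diff)
  moreover have "m = n - Suc k"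
    using Suc.hyps by simp
  ultimately obtain W where "unitary n W" "\<forall>i<n. \<forall>j<Suc k. W $$ (i,j) = S' $$ (i,j)"
    using Suc.hyps(1) by blast
  then show ?case
    using S'(2) by (auto simp: less_Suc_eq)
qed

section \<open>Direct sums and splitting off a reducing subspace\<close>

lemma dsum_nth:
  assumes "X \<in> SM k g" "Z \<in> SM m g" "t < g"
  shows "dsum X Z ! t = four_block_mat (X ! t) (0\<^sub>m k m) (0\<^sub>m m k) (Z ! t)"
  using assms SM_carrier[OF assms(1,3)] SM_carrier[OF assms(2,3)] by (simp add: dsum_def SM_length)

lemma dsum_dims:
  assumes "X \<in> SM k g" "Z \<in> SM m g" "0 < g"
  shows "length (dsum X Z) = g" "tdim (dsum X Z) = k + m"
proof -
  show len: "length (dsum X Z) = g"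
    using assms by (simp add: dsum_def SM_length)
  then have "hd (dsum X Z) = dsum X Z ! 0"
    using assms(3) by (intro hd_conv_nth) auto
  then show "tdim (dsum X Z) = k + m"
    using dsum_nth[OF assms] SM_carrier[OF assms(1,3)] SM_carrier[OF assms(2,3)] by (simp add: tdim_def)
qed

text \<open>The intertwining relation makes the range of \<open>S\<close> invariant under all
  \<open>Y ! t\<close>, and self-adjointness makes its orthogonal complement invariant too. In a
  unitary basis adapted to this splitting, \<open>Y\<close> is block diagonal with \<open>X\<close>
  in the first block.\<close>

lemma uequiv_if_isometry_intertwines:
  assumes "Y \<in> SM m g" "X \<in> SM k g" "0 < g" "matrix_convex g K" "Y \<in> K"
    and "isometry m k S" "\<And>t. t < g \<Longrightarrow> Y ! t * S = S * X ! t"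
  shows "uequiv Y X \<or> (\<exists>Z\<in>K. uequiv Y (dsum X Z))"
proof -
  obtain W where W: "unitary m W" "\<And>i j. i < m \<Longrightarrow> j < k \<Longrightarrow> W $$ (i,j) = S $$ (i,j)"
    using isometry_complete_to_unitary[OF assms(6)] by blast
  have Wc: "W \<in> carrier_mat m m" "unitary m (adj W)"
    using W(1) by (simp_all add: unitary_def)
  have S: "S \<in> carrier_mat m k" "adj S \<in> carrier_mat k m" "adj S * S = 1\<^sub>m k"
    using assms(6) by (auto simp: isometry_def)
  have len: "length Y = g" "tdim Y = m" "length X = g" "tdim X = k"
    using assms(1-3) SM_length SM_tdim by blast+
  have Yt: "Y ! t \<in> carrier_mat m m" and Xt: "X ! t \<in> carrier_mat k k" if "t < g" for t
    using SM_carrier that assms(1,2) by auto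
  have reduce: "Y ! t = adj (adj W) * (adj W * Y ! t * W) * adj W" if "t < g" for t
    using unitary_congruence_cancel[OF W(1) Yt[OF that]] by simp
  have SYS: "adj S * Y ! t * S = X ! t" if "t < g" for t
    using assoc_mult_mat[OF S(2) Yt[OF that] S(1)] assoc_mult_mat[OF S(2,1) Xt[OF that]]
      assms(7)[OF that] S(3) Xt[OF that] by simp
  show ?thesis
  \<comment> \<open>If \<open>k = m\<close> there is no complement, and members of \<open>K\<close>
    have size at least 1; this is the alternative without a summand \<open>Z\<close>.\<close>
  proof (cases "k = m")
    case True
    have "W = S"
      using W(2) Wc(1) S(1) True by (intro eq_matI) auto
    then have "Y ! t = adj (adj W) * X ! t * adj W" if "t < g" for t
      using reduce[OF that] SYS[OF that] by simp
    then have "uequiv Y X"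
      unfolding uequiv_def len using Wc(2) True by blast
    then show ?thesis ..
  next
    case False
    then have km: "k < m"
      using isometry_dim_le[OF assms(6)] by simp
    define T where "T = mat m (m - k) (\<lambda>(i,j). W $$ (i, j + k))"
    have T: "T \<in> carrier_mat m (m - k)"
      by (simp add: T_def)
    have Tij: "T $$ (a,i) = W $$ (a, i + k)" if "a < m" "i < m - k" for a i
      using that by (simp add: T_def)
    have "isometry m m W"
      using W(1) by (simp add: unitary_def isometry_def)
    then have ortho: "(\<Sum>a<m. cnj (W $$ (a,i)) * W $$ (a,j)) = of_bool (i = j)" if "i < m" "j < m" for i j
      using that isometry_index[OF Wc(1)] by simp
    have "isometry m (m - k) T"
      unfolding isometry_index[OF T] using ortho by (auto simp: T_def)
    then have TT: "adj T * T = 1\<^sub>m (m - k)"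
      by (simp add: isometry_def)
    have TS: "adj T * S = 0\<^sub>m (m - k) k"
    proof (rule eq_matI)
      fix i j assume "i < dim_row (0\<^sub>m (m - k) k :: complex mat)" "j < dim_col (0\<^sub>m (m - k) k :: complex mat)"
      then have ij: "i < m - k" "j < k"
        by auto
      then have "(adj T * S) $$ (i,j) = (\<Sum>a<m. cnj (W $$ (a,i + k)) * W $$ (a,j))"
        using T S(1) W(2) km Tij
        by (simp add: mult_index_sum[OF adj_carrier[OF T] S(1)] del: index_mult_mat(1))
      then show "(adj T * S) $$ (i,j) = 0\<^sub>m (m - k) k $$ (i,j)"
        using ij ortho[of "i + k" j] by simp
    qed (use T S in auto)
    \<comment> \<open>The compression of \<open>Y\<close> to the complement lies in \<open>K\<close>
      because it is a matrix convex combination with the single coefficient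
      \<open>T\<close>.\<close>
    define Z where "Z = mcomb g (m - k) [(Y,T)]"
    have ok: "mcomb_ok K (m - k) [(Y,T)]"
      using T TT km assms(5) len(2) by (simp add: mcomb_ok_def)
    have sub: "K \<subseteq> SMall g"
      using assms(4) by (simp add: matrix_convex_def)
    have ZK: "Z \<in> K"
      using ok assms(4) by (simp add: matrix_convex_def Z_def)
    have ZS: "Z \<in> SM (m - k) g"
      unfolding Z_def by (rule mcomb_SM[OF ok sub assms(3)])
    have Zt: "Z ! t = adj T * Y ! t * T" if "t < g" for t
      using congruence_carrier[OF Yt[OF that] T] that by (simp add: Z_def mcomb_nth)
    have TYS: "adj T * Y ! t * S = 0\<^sub>m (m - k) k" if "t < g" for t
      using assoc_mult_mat[OF adj_carrier[OF T] Yt[OF that] S(1)] assms(7)[OF that]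
        assoc_mult_mat[OF adj_carrier[OF T] S(1) Xt[OF that]] TS Xt[OF that] by simp
    \<comment> \<open>Taking adjoints of \<open>TYS\<close>: this is where self-adjointness of
      \<open>Y ! t\<close> turns an invariant subspace into a reducing one.\<close>
    have SYT: "adj S * Y ! t * T = 0\<^sub>m k (m - k)" if "t < g" for t
    proof -
      have "adj (adj T * Y ! t * S) = adj S * (adj (Y ! t) * T)"
        by (simp only: adj_mult[OF mult_carrier_mat[OF adj_carrier[OF T] Yt[OF that]] S(1)]
            adj_mult[OF adj_carrier[OF T] Yt[OF that]] adj_adj)
      also have "\<dots> = adj S * Y ! t * T"
        using SM_adj[OF assms(1) that] assoc_mult_mat[OF S(2) Yt[OF that] T] by simp
      finally show ?thesis
        using TYS[OF that] by simp
    qed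
    have block: "adj W * Y ! t * W = dsum X Z ! t" if t: "t < g" for t
      unfolding dsum_nth[OF assms(2) ZS t]
    proof (rule eq_matI)
      have Zc: "Z ! t \<in> carrier_mat (m - k) (m - k)"
        by (rule SM_carrier[OF ZS t])
      show "dim_row (adj W * Y ! t * W) = dim_row (four_block_mat (X ! t) (0\<^sub>m k (m - k)) (0\<^sub>m (m - k) k) (Z ! t))"
        "dim_col (adj W * Y ! t * W) = dim_col (four_block_mat (X ! t) (0\<^sub>m k (m - k)) (0\<^sub>m (m - k) k) (Z ! t))"
        using Wc(1) Xt[OF t] Zc km by auto
      fix i j
      assume "i < dim_row (four_block_mat (X ! t) (0\<^sub>m k (m - k)) (0\<^sub>m (m - k) k) (Z ! t))"
        "j < dim_col (four_block_mat (X ! t) (0\<^sub>m k (m - k)) (0\<^sub>m (m - k) k) (Z ! t))"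
      then have ij: "i < m" "j < m"
        using Xt[OF t] Zc km by auto
      note entry = triple_index_sum[OF Wc(1) Yt[OF t] Wc(1) ij]
      have "(adj W * Y ! t * W) $$ (i,j) =
          (if i < k then if j < k then (adj S * Y ! t * S) $$ (i,j) else (adj S * Y ! t * T) $$ (i,j - k)
           else if j < k then (adj T * Y ! t * S) $$ (i - k,j) else (adj T * Y ! t * T) $$ (i - k,j - k))"
        unfolding entry using ij W(2)
        by (auto simp: triple_index_sum[OF S(1) Yt[OF t] S(1)] triple_index_sum[OF S(1) Yt[OF t] T]
            triple_index_sum[OF T Yt[OF t] S(1)] triple_index_sum[OF T Yt[OF t] T] Tij
            simp del: index_mult_mat(1) intro!: sum.cong)
      also have "\<dots> = four_block_mat (X ! t) (0\<^sub>m k (m - k)) (0\<^sub>m (m - k) k) (Z ! t) $$ (i,j)"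
        unfolding SYS[OF t] SYT[OF t] TYS[OF t] Zt[OF t, symmetric]
        using ij Xt[OF t] Zc km by auto
      finally show "(adj W * Y ! t * W) $$ (i,j) =
          four_block_mat (X ! t) (0\<^sub>m k (m - k)) (0\<^sub>m (m - k) k) (Z ! t) $$ (i,j)" .
    qed
    have "Y ! t = adj (adj W) * dsum X Z ! t * adj W" if "t < g" for t
      using reduce[OF that] block[OF that] by simp
    moreover have "length (dsum X Z) = g" "tdim (dsum X Z) = m"
      using dsum_dims[OF assms(2) ZS assms(3)] km by auto
    ultimately have "uequiv Y (dsum X Z)"
      unfolding uequiv_def len using Wc(2) by auto
    with ZK show ?thesis
      by blast
  qed
qed

section \<open>Free extreme points\<close>

text \<open>A zero of the form is a null vector of the pencil. Written out for the four blocks of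
  the Pauli pencil, the null vector equation in row \<open>a\<close> consists of these two
  identities.\<close>

lemma form_pauli_null:
  assumes "Y \<in> SM m 3" "Y \<in> free_spec 2 pauli" "Z \<in> carrier_mat m 2" "Re (form Y pauli Z) = 0" "a < m"
  shows "Z $$ (a,0) = (Y ! 0 * Z) $$ (a,0) + (Y ! 1 * Z) $$ (a,1) + \<i> * (Y ! 2 * Z) $$ (a,1)"
    and "Z $$ (a,1) = (Y ! 1 * Z) $$ (a,0) - \<i> * (Y ! 2 * Z) $$ (a,0) - (Y ! 0 * Z) $$ (a,1)"
proof -
  \<comment> \<open>The explicit blocks are available with P as the first factor, whereas the
    hypothesis has it second; hence the transposition.\<close>
  have ZT: "transpose_mat Z \<in> carrier_mat 2 m"
    using assms(3) by simp
  have "Re (form pauli Y (transpose_mat Z)) = 0"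
    using form_commute[OF assms(1) pauli_SM assms(3)] assms(4) by simp
  then have null: "(\<Sum>b\<in>{..<2} \<times> {..<m}. pencil_kernel pauli Y (i,a) b * transpose_mat Z $$ b) = 0" if "i < 2" for i
    using that assms(5)
    by (intro pencil_kernel_null[OF pauli_SM assms(1) form_pauli_nonneg[OF assms(1,2)] ZT]) auto
  have Yc: "Y ! t \<in> carrier_mat m m" if "t < 3" for t
    using SM_carrier[OF assms(1) that] .
  have YZ: "(\<Sum>b<m. Y ! t $$ (a,b) * Z $$ (b,j)) = (Y ! t * Z) $$ (a,j)" if "t < 3" "j < 2" for t j
    using mult_index_sum[OF Yc[OF that(1)] assms(3,5) that(2)] by simp
  have id: "(\<Sum>b<m. of_bool (a = b) * Z $$ (b,j)) = Z $$ (a,j)" for j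
    using assms(5) by (simp add: of_bool_def if_distribR if_distrib cong: if_cong)
  have split: "(\<Sum>b\<in>{..<2} \<times> {..<m}. pencil_kernel pauli Y (i,a) b * transpose_mat Z $$ b) =
      (\<Sum>b<m. pencil_kernel pauli Y (i,a) (0,b) * Z $$ (b,0)) +
      (\<Sum>b<m. pencil_kernel pauli Y (i,a) (1,b) * Z $$ (b,1))" for i
    using assms(3) by (simp add: sum.cartesian_product' lessThan_2)
  show "Z $$ (a,0) = (Y ! 0 * Z) $$ (a,0) + (Y ! 1 * Z) $$ (a,1) + \<i> * (Y ! 2 * Z) $$ (a,1)"
    using null[of 0] YZ[of 0 0] YZ[of 1 1] YZ[of 2 1] id[of 0] unfolding split
    by (simp add: pencil_kernel_pauli left_diff_distrib distrib_right sum.distrib sum_subtractf sum_negf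
        mult.assoc flip: sum_distrib_left del: index_mult_mat(1)) (simp add: algebra_simps del: index_mult_mat(1))
  show "Z $$ (a,1) = (Y ! 1 * Z) $$ (a,0) - \<i> * (Y ! 2 * Z) $$ (a,0) - (Y ! 0 * Z) $$ (a,1)"
    using null[of 1] YZ[of 0 1] YZ[of 1 0] YZ[of 2 0] id[of 1] unfolding split
    by (simp add: pencil_kernel_pauli left_diff_distrib distrib_right sum.distrib sum_subtractf sum_negf
        mult.assoc flip: sum_distrib_left del: index_mult_mat(1)) (simp add: algebra_simps del: index_mult_mat(1))
qed

text \<open>For each row the six entries of the three matrices \<open>Y ! t * V\<close> are
  unknowns. A basis of the symmetric test matrices gives three times two linear equations, and this
  system has the entries of \<open>V * pauli ! t\<close> as its only solution.\<close>

lemma pauli_intertwines: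
  assumes "Y \<in> SM m 3" "Y \<in> free_spec 2 pauli" "V \<in> carrier_mat m 2"
    and "\<And>C. C \<in> carrier_mat 2 2 \<Longrightarrow> form pauli pauli C = 0 \<Longrightarrow> Re (form Y pauli (V * C)) = 0"
    and "t < 3"
  shows "Y ! t * V = V * pauli ! t"
proof (rule eq_matI)
  have Yc: "Y ! t \<in> carrier_mat m m" if "t < 3" for t
    using SM_carrier[OF assms(1) that] .
  have Pc: "pauli ! t \<in> carrier_mat 2 2" if "t < 3" for t
    using SM_carrier[OF pauli_SM that] .
  show "dim_row (Y ! t * V) = dim_row (V * pauli ! t)" "dim_col (Y ! t * V) = dim_col (V * pauli ! t)"
    using Yc[OF assms(5)] Pc[OF assms(5)] assms(3) by auto
  fix a j assume "a < dim_row (V * pauli ! t)" "j < dim_col (V * pauli ! t)"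
  then have a: "a < m" and j: "j < 2"
    using Pc[OF assms(5)] assms(3) by auto
  define w where "w t j = (Y ! t * V) $$ (a,j)" for t j
  have col: "(V * C) $$ (a,j) = V $$ (a,0) * C $$ (0,j) + V $$ (a,1) * C $$ (1,j)"
    if "C \<in> carrier_mat 2 2" "j < 2" for C j
    using mult_index_sum[OF assms(3) that(1) a that(2)] by (simp add: lessThan_2)
  have col': "(Y ! t * (V * C)) $$ (a,j) = w t 0 * C $$ (0,j) + w t 1 * C $$ (1,j)"
    if "C \<in> carrier_mat 2 2" "j < 2" "t < 3" for C j t
    using mult_index_sum[OF mult_carrier_mat[OF Yc[OF that(3)] assms(3)] that(1) a that(2)]
      assoc_mult_mat[OF Yc[OF that(3)] assms(3) that(1)] by (simp add: lessThan_2 w_def)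
  have eqs: "V $$ (a,0) * C $$ (0,0) + V $$ (a,1) * C $$ (1,0) =
      w 0 0 * C $$ (0,0) + w 0 1 * C $$ (1,0) + (w 1 0 * C $$ (0,1) + w 1 1 * C $$ (1,1)) +
      \<i> * (w 2 0 * C $$ (0,1) + w 2 1 * C $$ (1,1))"
    "V $$ (a,0) * C $$ (0,1) + V $$ (a,1) * C $$ (1,1) =
      w 1 0 * C $$ (0,0) + w 1 1 * C $$ (1,0) - \<i> * (w 2 0 * C $$ (0,0) + w 2 1 * C $$ (1,0)) -
      (w 0 0 * C $$ (0,1) + w 0 1 * C $$ (1,1))"
    if C: "C \<in> carrier_mat 2 2" and sym: "C $$ (0,1) = C $$ (1,0)" for C
  proof -
    have lt: "0 < (3::nat)" "1 < (3::nat)" "2 < (3::nat)"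
      by simp_all
    have "Re (form Y pauli (V * C)) = 0"
      using C sym by (intro assms(4)) (simp_all add: form_pauli_pauli)
    note null = form_pauli_null[OF assms(1,2) mult_carrier_mat[OF assms(3) C] this a]
    have col01: "(V * C) $$ (a,0) = V $$ (a,0) * C $$ (0,0) + V $$ (a,1) * C $$ (1,0)"
      "(V * C) $$ (a,1) = V $$ (a,0) * C $$ (0,1) + V $$ (a,1) * C $$ (1,1)"
      "\<And>t. t < 3 \<Longrightarrow> (Y ! t * (V * C)) $$ (a,0) = w t 0 * C $$ (0,0) + w t 1 * C $$ (1,0)"
      "\<And>t. t < 3 \<Longrightarrow> (Y ! t * (V * C)) $$ (a,1) = w t 0 * C $$ (0,1) + w t 1 * C $$ (1,1)"
      using col[OF C] col'[OF C] by auto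
    show "V $$ (a,0) * C $$ (0,0) + V $$ (a,1) * C $$ (1,0) =
        w 0 0 * C $$ (0,0) + w 0 1 * C $$ (1,0) + (w 1 0 * C $$ (0,1) + w 1 1 * C $$ (1,1)) +
        \<i> * (w 2 0 * C $$ (0,1) + w 2 1 * C $$ (1,1))"
      using null(1) by (simp only: col01(1,2) col01(3,4)[OF lt(1)] col01(3,4)[OF lt(2)] col01(3,4)[OF lt(3)])
    show "V $$ (a,0) * C $$ (0,1) + V $$ (a,1) * C $$ (1,1) =
        w 1 0 * C $$ (0,0) + w 1 1 * C $$ (1,0) - \<i> * (w 2 0 * C $$ (0,0) + w 2 1 * C $$ (1,0)) -
        (w 0 0 * C $$ (0,1) + w 0 1 * C $$ (1,1))"
      using null(2) by (simp only: col01(1,2) col01(3,4)[OF lt(1)] col01(3,4)[OF lt(2)] col01(3,4)[OF lt(3)])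
  qed
  \<comment> \<open>The basis consists of E_00, E_11 and E_01 + E_10.\<close>
  have E00: "V $$ (a,0) = w 0 0" "0 = w 1 0 - \<i> * w 2 0"
    using eqs[of "mat 2 2 (\<lambda>(i,j). of_bool (i = 0 \<and> j = 0))"] by simp_all
  have E11: "0 = w 1 1 + \<i> * w 2 1" "V $$ (a,1) = - w 0 1"
    using eqs[of "mat 2 2 (\<lambda>(i,j). of_bool (i = 1 \<and> j = 1))"] by simp_all
  have E01: "V $$ (a,1) = w 0 1 + w 1 0 + \<i> * w 2 0" "V $$ (a,0) = w 1 1 - \<i> * w 2 1 - w 0 0"
    using eqs[of "mat 2 2 (\<lambda>(i,j). of_bool (i \<noteq> j))"] by simp_all
  have w1: "w 1 0 = V $$ (a,1)" "w 1 1 = V $$ (a,0)"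
    using E00 E11 E01 by (auto simp: algebra_simps complex_eq_iff)
  have w2: "w 2 0 = - \<i> * V $$ (a,1)" "w 2 1 = \<i> * V $$ (a,0)"
    using E00 E11 w1 by (auto simp: algebra_simps complex_eq_iff)
  have "t = 0 \<or> t = Suc 0 \<or> t = 2" "j = 0 \<or> j = Suc 0"
    using assms(5) j by auto
  then have "w t j = V $$ (a,0) * pauli ! t $$ (0,j) + V $$ (a,1) * pauli ! t $$ (1,j)"
    using E00 E11 w1 w2 by (auto simp: algebra_simps)
  then show "(Y ! t * V) $$ (a,j) = (V * pauli ! t) $$ (a,j)"
    using col[OF Pc[OF assms(5)] j] by (simp add: w_def)
qed

text \<open>Irreducibility of the tuple: commuting with P_1 makes \<open>G\<close> diagonal, and
  commuting with P_2 makes its diagonal constant.\<close>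

lemma pauli_commutant:
  assumes "G \<in> carrier_mat 2 2" "\<And>t. t < 3 \<Longrightarrow> G * pauli ! t = pauli ! t * G"
  shows "G = (G $$ (0,0)) \<cdot>\<^sub>m 1\<^sub>m 2"
proof -
  have comm: "G $$ (i,0) * pauli ! t $$ (0,j) + G $$ (i,1) * pauli ! t $$ (1,j) =
      pauli ! t $$ (i,0) * G $$ (0,j) + pauli ! t $$ (i,1) * G $$ (1,j)" if "t < 3" "i < 2" "j < 2" for t i j
    using assms(2)[OF that(1)] mult_index_sum[OF assms(1) SM_carrier[OF pauli_SM that(1)] that(2,3)]
      mult_index_sum[OF SM_carrier[OF pauli_SM that(1)] assms(1) that(2,3)] by (simp add: lessThan_2)
  have "G $$ (0,1) = 0" "G $$ (1,0) = 0" "G $$ (1,1) = G $$ (0,0)"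
    using comm[of 0 0 1] comm[of 0 1 0] comm[of 1 0 1] by auto
  with assms(1) show ?thesis
    by (intro eq_matI) (auto simp: less_2_cases_iff)
qed

lemma free_extreme_pauli: "free_extreme 3 (free_spec 2 pauli) pauli"
  unfolding free_extreme_def pauli_tdim
proof (intro conjI pauli_in_free_spec allI impI ballI)
  let ?K = "free_spec 2 pauli"
  fix L x
  assume L: "mcomb_ok ?K 2 L \<and> (\<forall>(Y,V)\<in>set L. V \<noteq> 0\<^sub>m (tdim Y) 2) \<and> pauli = mcomb 3 2 L"
    and x: "x \<in> set L"
  obtain Y V where YV: "x = (Y,V)"
    by (cases x)
  let ?m = "tdim Y"
  have cvx: "matrix_convex 3 ?K"
    using matrix_convex_free_spec[OF pauli_SM] by simp
  then have sub: "?K \<subseteq> SMall 3"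
    by (simp add: matrix_convex_def)
  have Lok: "mcomb_ok ?K 2 L"
    using L by blast
  have mem: "Y \<in> ?K" "Y \<in> SM ?m 3" "V \<in> carrier_mat ?m 2" "V \<noteq> 0\<^sub>m ?m 2"
    using mcomb_okD[OF Lok sub] L x YV by auto
  have null: "Re (form Y pauli (V * C)) = 0" if C: "C \<in> carrier_mat 2 2" "form pauli pauli C = 0" for C
  proof -
    have "(\<Sum>(Y,V)\<leftarrow>L. form Y pauli (V * C)) = 0"
      using form_mcomb[OF Lok sub _ pauli_SM C(1)] L C(2) by simp
    then have "Re (\<Sum>x\<leftarrow>L. case x of (Y,V) \<Rightarrow> form Y pauli (V * C)) = 0"
      by simp
    moreover have "Re (\<Sum>x\<leftarrow>L. f x) = (\<Sum>x\<leftarrow>L. Re (f x))" for f :: "complex mat list \<times> complex mat \<Rightarrow> complex"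
      by (induction L) auto
    ultimately have "(\<Sum>x\<leftarrow>L. Re (case x of (Y,V) \<Rightarrow> form Y pauli (V * C))) = 0"
      by simp
    moreover have "0 \<le> Re (case x of (Y,V) \<Rightarrow> form Y pauli (V * C))" if "x \<in> set L" for x
    proof (cases x)
      case (Pair Y V)
      then show ?thesis
        using mcomb_okD[OF Lok sub _ that[unfolded Pair]] free_spec_iff[OF pauli_SM] C(1) by auto
    qed
    ultimately show ?thesis
      using x YV by (subst (asm) sum_list_nonneg_eq_0_iff) auto
  qed
  have inter: "Y ! t * V = V * pauli ! t" if "t < 3" for t
    using pauli_intertwines[OF mem(2,1,3) null that] by blast
  define G where "G = adj V * V"
  have G: "G \<in> carrier_mat 2 2"
    using mem(3) unfolding G_def by (intro mult_carrier_mat[of _ 2 ?m] adj_carrier)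
  \<comment> \<open>The matrix \<open>adj V * Y ! t * V\<close> is self-adjoint and equals
    \<open>G * pauli ! t\<close>, a product of self-adjoint matrices; these factors must
    commute.\<close>
  have "G * pauli ! t = pauli ! t * G" if t: "t < 3" for t
  proof -
    have c: "Y ! t \<in> carrier_mat ?m ?m" "pauli ! t \<in> carrier_mat 2 2" "adj (Y ! t) = Y ! t" "adj (pauli ! t) = pauli ! t"
      using SM_carrier[OF mem(2) t] SM_carrier[OF pauli_SM t] SM_adj[OF mem(2) t] SM_adj[OF pauli_SM t] by auto
    have e: "adj V * Y ! t * V = G * pauli ! t"
      using assoc_mult_mat[OF adj_carrier[OF mem(3)] c(1) mem(3)] inter[OF t]
        assoc_mult_mat[OF adj_carrier[OF mem(3)] mem(3) c(2)] by (simp add: G_def)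
    have "adj G = G"
      using adj_mult[OF adj_carrier[OF mem(3)] mem(3)] by (simp add: G_def)
    then have "adj (G * pauli ! t) = pauli ! t * G"
      using adj_mult[OF G c(2)] c(4) by simp
    moreover have "adj (G * pauli ! t) = G * pauli ! t"
      using adj_congruence[OF c(1) mem(3)] c(3) e by simp
    ultimately show ?thesis
      by simp
  qed
  then have scalar: "G = G $$ (0,0) \<cdot>\<^sub>m 1\<^sub>m 2"
    by (rule pauli_commutant[OF G])
  \<comment> \<open>The scalar \<open>l\<close> with \<open>G = l I\<close> is the common squared
    norm of both columns of \<open>V\<close>, so it is positive because \<open>V\<close> is
    nonzero.\<close>
  define l where "l = (\<Sum>a<?m. (cmod (V $$ (a,0)))\<^sup>2)"
  have G_diag: "G $$ (j,j) = of_real (\<Sum>a<?m. (cmod (V $$ (a,j)))\<^sup>2)" if "j < 2" for j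
    unfolding G_def mult_index_sum[OF adj_carrier[OF mem(3)] mem(3) that that] of_real_sum complex_norm_square
    using mem(3) that by (intro sum.cong refl) simp
  have l: "G $$ (0,0) = of_real l"
    using G_diag[of 0] by (simp add: l_def)
  have "G $$ (1,1) = of_real l"
    using arg_cong[OF scalar, of "\<lambda>M. M $$ (1,1)"] l by simp
  then have l': "(\<Sum>a<?m. (cmod (V $$ (a,1)))\<^sup>2) = l"
    using G_diag[of 1] by (simp del: of_real_sum)
  have "l \<noteq> 0"
  proof
    assume "l = 0"
    then have "V $$ (a,j) = 0" if "a < ?m" "j < 2" for a j
      using that l' by (auto simp: l_def sum_nonneg_eq_0_iff less_2_cases_iff)
    then have "V = 0\<^sub>m ?m 2"
      using mem(3) by (intro eq_matI) auto
    with mem(4) show False ..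
  qed
  moreover have "l \<ge> 0"
    by (simp add: l_def sum_nonneg)
  ultimately have lpos: "l > 0"
    by simp
  \<comment> \<open>Rescaling by \<open>1 / sqrt l\<close> makes \<open>V\<close> an isometry and
    preserves the intertwining relation.\<close>
  define c where "c = complex_of_real (1 / sqrt l)"
  define S where "S = c \<cdot>\<^sub>m V"
  have S: "S \<in> carrier_mat ?m 2"
    using mem(3) by (simp add: S_def)
  have cc: "cnj c * c * of_real l = 1"
    using lpos by (simp add: c_def flip: of_real_mult)
  have "(\<Sum>a<?m. cnj (S $$ (a,i)) * S $$ (a,j)) = of_bool (i = j)" if "i < 2" "j < 2" for i j
  proof -
    have "(\<Sum>a<?m. cnj (S $$ (a,i)) * S $$ (a,j)) = cnj c * c * G $$ (i,j)"
      unfolding G_def mult_index_sum[OF adj_carrier[OF mem(3)] mem(3) that] sum_distrib_left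
      using mem(3) that by (intro sum.cong refl) (simp add: S_def)
    also have "G $$ (i,j) = of_real l * of_bool (i = j)"
      using arg_cong[OF scalar, of "\<lambda>M. M $$ (i,j)"] that l by simp
    finally show ?thesis
      using cc by (simp add: mult.assoc[symmetric])
  qed
  then have "isometry ?m 2 S"
    unfolding isometry_index[OF S] by simp
  moreover have "Y ! t * S = S * pauli ! t" if "t < 3" for t
    using inter[OF that] mult_smult_distrib[OF SM_carrier[OF mem(2) that] mem(3), of c]
      mult_smult_assoc_mat[OF mem(3) SM_carrier[OF pauli_SM that], of c] by (simp add: S_def)
  ultimately have "uequiv Y pauli \<or> (\<exists>Z\<in>?K. uequiv Y (dsum pauli Z))"
    using uequiv_if_isometry_intertwines[OF mem(2) pauli_SM _ cvx mem(1)] by simp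
  then show "case x of (Y,V) \<Rightarrow> uequiv Y pauli \<or> (\<exists>Z\<in>?K. uequiv Y (dsum pauli Z))"
    using YV by simp
qed

section \<open>Uniqueness of the free extreme point\<close>

lemma foldr_mat_filter:
  fixes f :: "'a \<Rightarrow> 'b :: comm_monoid_add mat"
  assumes "\<And>x. x \<in> set xs \<Longrightarrow> f x \<in> carrier_mat m n" "\<And>x. x \<in> set xs \<Longrightarrow> \<not> Q x \<Longrightarrow> f x = 0\<^sub>m m n"
  shows "foldr (+) (map f (filter Q xs)) (0\<^sub>m m n) = foldr (+) (map f xs) (0\<^sub>m m n)"
  using assms
proof (induction xs)
  case (Cons x xs)
  have "foldr (+) (map f xs) (0\<^sub>m m n) \<in> carrier_mat m n"
    using Cons.prems(1) by (intro foldr_mat_carrier) auto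
  with Cons show ?case
    by auto
qed simp

lemma unitary_congruence_mult:
  assumes "unitary n U" "A \<in> carrier_mat n n" "B \<in> carrier_mat n n"
  shows "adj U * A * U * (adj U * B * U) = adj U * (A * B) * U"
proof -
  have U: "U \<in> carrier_mat n n" "adj U \<in> carrier_mat n n" "U * adj U = 1\<^sub>m n"
    using assms(1) by (auto simp: unitary_def)
  note c = mult_carrier_mat[OF U(2) assms(2)] mult_carrier_mat[OF assms(3) U(1)]
  have "adj U * A * U * (adj U * B * U) = adj U * A * (U * (adj U * (B * U)))"
    by (simp only: assoc_mult_mat[OF U(2) assms(3) U(1)]
        assoc_mult_mat[OF c(1) U(1) mult_carrier_mat[OF U(2) c(2)]])
  also have "U * (adj U * (B * U)) = B * U"
    by (simp only: assoc_mult_mat[OF U(1,2) c(2), symmetric] U(3) left_mult_one_mat[OF c(2)])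
  also have "adj U * A * (B * U) = adj U * A * B * U"
    by (rule assoc_mult_mat[OF c(1) assms(3) U(1), symmetric])
  also have "adj U * A * B = adj U * (A * B)"
    by (rule assoc_mult_mat[OF U(2) assms(2,3)])
  finally show ?thesis .
qed

text \<open>By size both summands would be 1 by 1, so the matrices of the direct sum are diagonal
  and commute, while P_1 and P_2 do not.\<close>

lemma pauli_not_uequiv_dsum:
  assumes "X \<in> SM n 3" "1 \<le> n" "Z \<in> SM m 3" "1 \<le> m"
  shows "\<not> uequiv pauli (dsum X Z)"
proof
  assume "uequiv pauli (dsum X Z)"
  moreover have "tdim (dsum X Z) = n + m"
    using dsum_dims(2)[OF assms(1,3)] by simp
  ultimately obtain U where dims: "n + m = 2" and U: "unitary 2 U"
    "\<And>t. t < 3 \<Longrightarrow> pauli ! t = adj U * dsum X Z ! t * U"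
    unfolding uequiv_def pauli_tdim pauli_length by metis
  have nm: "n = 1" "m = 1"
    using dims assms(2,4) by auto
  have Uc: "U \<in> carrier_mat 2 2" "adj U \<in> carrier_mat 2 2" "U * adj U = 1\<^sub>m 2"
    using U(1) by (auto simp: unitary_def)
  define D where "D t = dsum X Z ! t" for t
  have XZ: "X ! t \<in> carrier_mat 1 1" "Z ! t \<in> carrier_mat 1 1" if "t < 3" for t
    using SM_carrier that assms nm by auto
  have D: "D t \<in> carrier_mat 2 2" "D t $$ (0,1) = 0" "D t $$ (1,0) = 0" if "t < 3" for t
    using dsum_nth[OF assms(1,3) that] XZ[OF that] nm
    by (auto simp: D_def intro!: carrier_matI)
  have comm: "D 0 * D 1 = D 1 * D 0"
  proof (rule eq_matI)
    fix i j assume "i < dim_row (D 1 * D 0)" "j < dim_col (D 1 * D 0)"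
    then have ij: "i < 2" "j < 2"
      using D(1)[of 0] D(1)[of 1] by auto
    show "(D 0 * D 1) $$ (i,j) = (D 1 * D 0) $$ (i,j)"
      using ij D[of 0] D[of 1]
      by (auto simp: mult_index_sum[of _ 2 2 _ 2] lessThan_2 less_2_cases_iff simp del: index_mult_mat(1))
  qed (use D(1)[of 0] D(1)[of 1] in auto)
  have prod: "pauli ! s * pauli ! t = adj U * (D s * D t) * U" if "s < 3" "t < 3" for s t
    unfolding U(2)[OF that(1)] U(2)[OF that(2)] D_def[symmetric]
    by (rule unitary_congruence_mult[OF U(1) D(1)[OF that(1)] D(1)[OF that(2)]])
  \<comment> \<open>P_1 and P_2 anticommute; at this entry the two products are 1 and -1.\<close>
  have "(pauli ! 0 * pauli ! 1) $$ (0,1) = (pauli ! 1 * pauli ! 0) $$ (0,1)"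
    using prod[of 0 1] prod[of 1 0] comm by simp
  then show False
    using SM_carrier[OF pauli_SM, of 0] SM_carrier[OF pauli_SM, of 1]
    by (simp add: mult_index_sum[of _ 2 2 _ 2] lessThan_2 del: index_mult_mat(1))
qed

text \<open>All points in the Kraus representation of \<open>X\<close> are copies of P, so
  extremality of \<open>X\<close> is a statement about P: it is equivalent to \<open>X\<close> or to
  a direct sum containing \<open>X\<close>, and it admits no direct sum.\<close>

lemma free_extreme_uequiv_pauli:
  assumes "free_extreme 3 (free_spec 2 pauli) X"
  shows "uequiv X pauli"
proof -
  let ?K = "free_spec 2 pauli"
  have XK: "X \<in> ?K"
    using assms by (simp add: free_extreme_def)
  have KS: "Y \<in> SM (tdim Y) 3" "1 \<le> tdim Y" if "Y \<in> ?K" for Y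
    using that free_spec_iff[OF pauli_SM, of Y] SMall_iff[of 3 Y] by simp_all
  let ?n = "tdim X"
  have n: "X \<in> SM ?n 3" "1 \<le> ?n"
    using KS[OF XK] by auto
  obtain Vs where ok: "mcomb_ok {pauli} ?n (map (Pair pauli) Vs)" and X: "X = mcomb 3 ?n (map (Pair pauli) Vs)"
    using free_spec_pauli_kraus[OF n XK] .
  have Vs: "V \<in> carrier_mat 2 ?n" if "V \<in> set Vs" for V
    using ok that by (auto simp: mcomb_ok_def pauli_tdim)
  \<comment> \<open>Extremality only concerns combinations with nonzero coefficients, and the
    factorization may produce zero Kraus operators.\<close>
  define Ws where "Ws = filter (\<lambda>V. V \<noteq> 0\<^sub>m 2 ?n) Vs"
  let ?L = "map (Pair pauli) Ws"
  have "foldr (+) (map (\<lambda>(Y,V). adj V * V) ?L) (0\<^sub>m ?n ?n) = foldr (+) (map (\<lambda>V. adj V * V) Vs) (0\<^sub>m ?n ?n)"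
    unfolding Ws_def map_map o_def prod.case
    by (intro foldr_mat_filter) (auto intro!: mult_carrier_mat[OF adj_carrier] dest: Vs)
  then have one: "foldr (+) (map (\<lambda>(Y,V). adj V * V) ?L) (0\<^sub>m ?n ?n) = 1\<^sub>m ?n"
    using ok by (simp add: mcomb_ok_def o_def)
  have "Ws \<noteq> []"
  proof
    assume "Ws = []"
    with one have "(0\<^sub>m ?n ?n :: complex mat) $$ (0,0) = 1\<^sub>m ?n $$ (0,0)"
      by simp
    with n show False
      by simp
  qed
  then obtain W where W: "W \<in> set Ws"
    by fastforce
  have Lok: "mcomb_ok ?K ?n ?L"
    unfolding mcomb_ok_def using one \<open>Ws \<noteq> []\<close> n Vs pauli_in_free_spec by (auto simp: Ws_def pauli_tdim)
  have XL: "X = mcomb 3 ?n ?L"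
  proof -
    have "foldr (+) (map (\<lambda>V. adj V * (pauli ! t) * V) Ws) (0\<^sub>m ?n ?n) =
        foldr (+) (map (\<lambda>V. adj V * (pauli ! t) * V) Vs) (0\<^sub>m ?n ?n)" if "t < 3" for t
      unfolding Ws_def
    proof (rule foldr_mat_filter)
      show "adj V * (pauli ! t) * V \<in> carrier_mat ?n ?n" if "V \<in> set Vs" for V
        using SM_carrier[OF pauli_SM \<open>t < 3\<close>] Vs[OF that] by (rule congruence_carrier)
      show "adj V * (pauli ! t) * V = 0\<^sub>m ?n ?n" if "\<not> V \<noteq> 0\<^sub>m 2 ?n" for V
        using that SM_carrier[OF pauli_SM \<open>t < 3\<close>] by simp
    qed
    then have "mcomb 3 ?n ?L = mcomb 3 ?n (map (Pair pauli) Vs)"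
      unfolding mcomb_def by (intro map_cong refl) (auto simp: o_def)
    with X show ?thesis
      by simp
  qed
  have "\<forall>(Y,V)\<in>set ?L. V \<noteq> 0\<^sub>m (tdim Y) ?n"
    by (auto simp: Ws_def pauli_tdim)
  with assms Lok XL have "\<forall>(Y,V)\<in>set ?L. uequiv Y X \<or> (\<exists>Z\<in>?K. uequiv Y (dsum X Z))"
    unfolding free_extreme_def by blast
  then have "uequiv pauli X \<or> (\<exists>Z\<in>?K. uequiv pauli (dsum X Z))"
    using W by auto
  moreover have "\<not> uequiv pauli (dsum X Z)" if "Z \<in> ?K" for Z
    by (rule pauli_not_uequiv_dsum[OF n KS[OF that]])
  ultimately have eq: "uequiv pauli X"
    by blast
  then have "?n = 2"
    by (simp add: uequiv_def pauli_tdim)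
  with n(1) eq show ?thesis
    using uequiv_sym[OF pauli_SM] by simp
qed

section \<open>The conjugate Pauli tuple\<close>

text \<open>Conjugating the entries of P amounts to a sign change of the third matrix. In this form
  the passage is a linear involution on all tuples, so self-duality transfers from P to its
  conjugate without a second Choi argument.\<close>

definition flip :: "complex mat list \<Rightarrow> complex mat list" where
  "flip X = [X ! 0, X ! 1, - (X ! 2)]"

lemma flip_SM:
  assumes "X \<in> SM n 3"
  shows "flip X \<in> SM n 3"
proof -
  have "adj (- (X ! 2)) = - adj (X ! 2)"
    by (intro eq_matI) auto
  then have "flip X ! t \<in> carrier_mat n n \<and> adj (flip X ! t) = flip X ! t" if "t \<in> {0, Suc 0, 2}" for t
    using that SM_carrier[OF assms, of t] SM_adj[OF assms, of t] by (auto simp: flip_def)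
  moreover have "t \<in> {0, Suc 0, 2}" if "t < 3" for t :: nat
    using that by auto
  moreover have "length (flip X) = 3"
    by (simp add: flip_def)
  ultimately show ?thesis
    by (simp add: SM_def)
qed

lemma flip_flip: "X \<in> SM n 3 \<Longrightarrow> flip (flip X) = X"
  using SM_length[of X n 3] by (intro nth_equalityI) (auto simp: flip_def less_Suc_eq numeral_3_eq_3 numeral_2_eq_2)

lemma flip_SMall:
  assumes "X \<in> SMall 3"
  shows "flip X \<in> SMall 3" "tdim (flip X) = tdim X"
proof -
  obtain n where n: "1 \<le> n" "X \<in> SM n 3"
    using assms by (auto simp: SMall_def)
  show "flip X \<in> SMall 3"
    using n flip_SM[OF n(2)] unfolding SMall_def by blast
  show "tdim (flip X) = tdim X"
    using SM_tdim[OF flip_SM[OF n(2)]] SM_tdim[OF n(2)] by simp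
qed

lemma flip_pauli: "flip pauli = pauli_bar"
  by (auto simp: flip_def pauli_bar_def pauli_nth pauli_def mat_of_rows_list_def less_Suc_eq numeral_2_eq_2 intro!: eq_matI)

text \<open>The sign sits on one factor of \<open>Y_3 \<otimes> X_3\<close> and may be moved to the
  other.\<close>

lemma form_flip:
  assumes "Y \<in> SM d 3" "X \<in> SM n 3" "Z \<in> carrier_mat d n"
  shows "form (flip Y) X Z = form Y (flip X) Z"
proof -
  have "flip Y ! t * Z * transpose_mat (X ! t) = Y ! t * Z * transpose_mat (flip X ! t)" if "t \<in> {0, Suc 0, 2}" for t
  proof -
    have c: "Y ! t \<in> carrier_mat d d" "X ! t \<in> carrier_mat n n" "transpose_mat (X ! t) \<in> carrier_mat n n"
      using that SM_carrier[OF assms(1), of t] SM_carrier[OF assms(2), of t] by auto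
    have "transpose_mat (- X ! t) = - transpose_mat (X ! t)"
      using c by (intro eq_matI) auto
    moreover have "- Y ! t * Z * transpose_mat (X ! t) = Y ! t * Z * (- transpose_mat (X ! t))"
      using c assms(3) by simp
    ultimately show ?thesis
      using that by (auto simp: flip_def)
  qed
  then have "(\<Sum>t<3. ip Z (flip Y ! t * Z * transpose_mat (X ! t))) =
      (\<Sum>t<3. ip Z (Y ! t * Z * transpose_mat (flip X ! t)))"
    unfolding lessThan_3 by (intro sum.cong refl arg_cong[of _ _ "ip Z"]) auto
  moreover have "length (flip Y) = 3"
    by (simp add: flip_def)
  ultimately show ?thesis
    using SM_length[OF assms(1)] by (simp only: form_def)
qed

lemma free_spec_pauli_bar_iff:
  assumes "X \<in> SMall 3"
  shows "X \<in> free_spec 2 pauli_bar \<longleftrightarrow> flip X \<in> free_spec 2 pauli"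
proof -
  have bar: "pauli_bar \<in> SM 2 3"
    using flip_SM[OF pauli_SM] flip_pauli by simp
  have XS: "X \<in> SM (tdim X) 3"
    using assms SMall_iff[of 3 X] by simp
  have "form (flip X) pauli Z = form X pauli_bar Z" if "Z \<in> carrier_mat (tdim X) 2" for Z
    using form_flip[OF XS pauli_SM that] flip_pauli by simp
  then have "(\<forall>Z\<in>carrier_mat (tdim X) 2. 0 \<le> Re (form X pauli_bar Z)) \<longleftrightarrow>
      (\<forall>Z\<in>carrier_mat (tdim (flip X)) 2. 0 \<le> Re (form (flip X) pauli Z))"
    unfolding flip_SMall(2)[OF assms] by (intro ball_cong refl) simp
  then show ?thesis
    using free_spec_iff[OF bar, of X] free_spec_iff[OF pauli_SM, of "flip X"] assms flip_SMall(1)[OF assms]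
    by (simp only: zero_less_numeral simp_thms)
qed

text \<open>\<open>flip\<close> maps one spectrahedron onto the other and, by
  \<open>form_flip\<close>, the polar of one onto the polar of the other, so the equality known for
  P is transported.\<close>

lemma free_polar_pauli_bar: "free_polar 3 (free_spec 2 pauli_bar) = free_spec 2 pauli_bar"
proof -
  let ?K = "free_spec 2 pauli" and ?B = "free_spec 2 pauli_bar"
  have "length pauli_bar = 3"
    by (simp add: pauli_bar_def)
  then have sub: "?K \<subseteq> SMall 3" "?B \<subseteq> SMall 3"
    by (auto simp: free_spec_def SMall_def)
  have SMX: "X \<in> SM (tdim X) 3" if "X \<in> SMall 3" for X
    using that SMall_iff[of 3 X] by simp
  have ff: "flip (flip X) = X" if "X \<in> SMall 3" for X
    using SMX[OF that] by (rule flip_flip)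
  have "X \<in> free_polar 3 ?B \<longleftrightarrow> flip X \<in> free_polar 3 ?K" if X: "X \<in> SMall 3" for X
  proof -
    have "(\<forall>Y\<in>?B. \<forall>Z\<in>carrier_mat (tdim Y) (tdim X). 0 \<le> Re (form Y X Z)) \<longleftrightarrow>
        (\<forall>Y\<in>?K. \<forall>Z\<in>carrier_mat (tdim Y) (tdim X). 0 \<le> Re (form Y (flip X) Z))" (is "?l \<longleftrightarrow> ?r")
    proof (intro iffI ballI)
      fix Y and Z :: "complex mat" assume l: ?l and Y: "Y \<in> ?K" and Z: "Z \<in> carrier_mat (tdim Y) (tdim X)"
      have YS: "Y \<in> SMall 3"
        using Y sub by blast
      then have "flip Y \<in> ?B"
        using flip_SMall free_spec_pauli_bar_iff ff Y by simp
      then have "0 \<le> Re (form (flip Y) X Z)"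
        using l Z flip_SMall[OF YS] by simp
      then show "0 \<le> Re (form Y (flip X) Z)"
        using form_flip[OF SMX[OF YS] SMX[OF X] Z] by simp
    next
      fix Y and Z :: "complex mat" assume r: ?r and Y: "Y \<in> ?B" and Z: "Z \<in> carrier_mat (tdim Y) (tdim X)"
      have YS: "Y \<in> SMall 3"
        using Y sub by blast
      then have fY: "flip Y \<in> ?K" "tdim (flip Y) = tdim Y"
        using flip_SMall free_spec_pauli_bar_iff Y by auto
      then have "0 \<le> Re (form (flip Y) (flip X) Z)"
        using r Z by simp
      moreover have "form (flip (flip Y)) X Z = form (flip Y) (flip X) Z"
        using form_flip[OF SMX[OF flip_SMall(1)[OF YS]] SMX[OF X]] Z fY(2) by simp
      ultimately show "0 \<le> Re (form Y X Z)"
        using ff[OF YS] by simp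
    qed
    then show ?thesis
      using free_polar_iff[OF sub(2), of X] free_polar_iff[OF sub(1), of "flip X"] flip_SMall[OF X] X by simp
  qed
  moreover have "free_polar 3 ?B \<subseteq> SMall 3"
    by (auto simp: free_polar_def SMall_def)
  ultimately have "X \<in> free_polar 3 ?B \<longleftrightarrow> X \<in> ?B" for X
    using sub(2) free_spec_pauli_bar_iff[of X] free_polar_pauli by (cases "X \<in> SMall 3") auto
  then show ?thesis
    by blast
qed

theorem mainTheorem1:
  shows "free_spec 2 pauli = free_polar 3 (free_spec 2 pauli)
     \<and> free_spec 2 pauli_bar = free_polar 3 (free_spec 2 pauli_bar)
     \<and> free_spec 2 pauli = mconv 3 {pauli}
     \<and> free_extreme 3 (free_spec 2 pauli) pauli
     \<and> (\<forall>X. free_extreme 3 (free_spec 2 pauli) X \<longrightarrow> uequiv X pauli)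
     \<and> free_spec 2 pauli = mconv 3 {X. free_extreme 3 (free_spec 2 pauli) X}"
proof (intro conjI allI impI)
  let ?E = "{X. free_extreme 3 (free_spec 2 pauli) X}"
  show "free_spec 2 pauli = mconv 3 ?E"
  proof
    show "free_spec 2 pauli \<subseteq> mconv 3 ?E"
      using mconv_mono[of "{pauli}" ?E 3] free_extreme_pauli mconv_pauli by auto
    show "mconv 3 ?E \<subseteq> free_spec 2 pauli"
      by (intro mconv_minimal matrix_convex_free_spec[OF pauli_SM]) (auto simp: free_extreme_def)
  qed
qed (simp_all add: free_polar_pauli free_polar_pauli_bar mconv_pauli free_extreme_pauli free_extreme_uequiv_pauli)

end
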